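(* $$\operatorname{diam}_L\big(\mathcal X_n^\epsilon\big)\ \asymp\ \log\left(\frac n\epsilon\right).$$
   Context: $a\asymp b$ means $\frac1K b\le a\le K b$ for a uniform constant $K$ (independent of $n$ and $\epsilon$). Let $R_n$ be a wedge of $n$ circles. $\mathcal X_n$ is the space of isometry classes of metric graphs $G$ that are homotopy equivalent to $R_n$, have all vertices of valence at least 3, and have volume (sum of edge lengths) equal to $n$; it is the quotient of Outer space by the outer automorphism group of the free group of rank $n$. The (asymmetric) Lipschitz metric on $\mathcal X_n$ is $d_L(G,H)=\min_f\log L(f)$, where $f$ is an $L(f)$-Lipschitz map from $G$ to $H$. The $\epsilon$-thick part $\mathcal X_n^\epsilon\subset\mathcal X_n$ is the set of graphs with no loop shorter than $\epsilon$. $\operatorname{diam}_L(\mathcal X_n^\epsilon)$ is the supremum of $d_L(G,H)$ over ordered pairs $G,H\in\mathcal X_n^\epsilon$.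
   Formalization: The comparison is proved for n ≥ 2 and 0 < ε ≤ 1, with f ranging over homotopy equivalences; with no bound on ε it fails, e.g. for n = 2, ε = 4/3 the thick part is a single theta graph, of diameter 0, while log(n/ε) > 0. *)

theory Defs
  imports "HOL-Analysis.Analysis" "Graph_Theory.Graph_Theory"
begin

text \<open>
  A finite graph (loops and multiple edges allowed) is a \<^typ>\<open>('v, 'e) pre_digraph\<close> in which every
  edge is stored as a single arc; the orientation of that arc is an arbitrary choice. Edge paths
  may traverse an edge in either direction: they are the walks of the graph below, in which
  \<open>(e, True)\<close> is \<open>e\<close> traversed from tail to head and \<open>(e, False)\<close> is its reverse.
\<close>

definition oriented :: "('v, 'e) pre_digraph \<Rightarrow> ('v, 'e \<times> bool) pre_digraph" where
  "oriented G = \<lparr> verts = verts G, arcs = arcs G \<times> UNIV,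
     tail = (\<lambda>(e, b). if b then tail G e else head G e),
     head = (\<lambda>(e, b). if b then head G e else tail G e) \<rparr>"

abbreviation edge_path ::
    "('v, 'e) pre_digraph \<Rightarrow> 'v \<Rightarrow> ('e \<times> bool) list \<Rightarrow> 'v \<Rightarrow> bool" where
  "edge_path G \<equiv> pre_digraph.awalk (oriented G)"

definition path_length :: "('e \<Rightarrow> real) \<Rightarrow> ('e \<times> bool) list \<Rightarrow> real" where
  "path_length l p = (\<Sum>(e, b)\<leftarrow>p. l e)"

definition metric_graph :: "('v, 'e) pre_digraph \<Rightarrow> ('e \<Rightarrow> real) \<Rightarrow> bool" where
  "metric_graph G l \<longleftrightarrow>
     fin_digraph G \<and> strongly_connected (oriented G) \<and> (\<forall>e\<in>arcs G. 0 < l e)"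

text \<open>A graph-theoretic loop at \<open>v\<close> contributes 2 to the valence of \<open>v\<close>.\<close>

definition valence :: "('v, 'e) pre_digraph \<Rightarrow> 'v \<Rightarrow> nat" where
  "valence G v = in_degree G v + out_degree G v"

definition volume :: "('v, 'e) pre_digraph \<Rightarrow> ('e \<Rightarrow> real) \<Rightarrow> real" where
  "volume G l = (\<Sum>e\<in>arcs G. l e)"

text \<open>
  The points of the geometric realization are the vertices and, for each edge \<open>e\<close>, the points
  \<open>Interior e t\<close> at distance \<open>t\<close> from the tail of \<open>e\<close> along \<open>e\<close>, where \<open>0 < t < l e\<close>.
\<close>

datatype ('v, 'e) gpoint = Vertex 'v | Interior 'e real

definition points :: "('v, 'e) pre_digraph \<Rightarrow> ('e \<Rightarrow> real) \<Rightarrow> ('v, 'e) gpoint set" where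
  "points G l = Vertex ` verts G \<union> {Interior e t | e t. e \<in> arcs G \<and> 0 < t \<and> t < l e}"

definition vertex_dist :: "('v, 'e) pre_digraph \<Rightarrow> ('e \<Rightarrow> real) \<Rightarrow> 'v \<Rightarrow> 'v \<Rightarrow> real" where
  "vertex_dist G l u v = Inf {path_length l p | p. edge_path G u p v}"

text \<open>
  The path metric. A shortest path from \<open>x\<close> to \<open>y\<close> either stays inside one open edge or leaves
  \<open>x\<close> through an end \<open>u\<close> of its edge and arrives at \<open>y\<close> through an end \<open>v\<close> of its edge.
\<close>

fun ends :: "('v, 'e) pre_digraph \<Rightarrow> ('e \<Rightarrow> real) \<Rightarrow> ('v, 'e) gpoint \<Rightarrow> ('v \<times> real) set" where
  "ends G l (Vertex v) = {(v, 0)}"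
| "ends G l (Interior e t) = {(tail G e, t), (head G e, l e - t)}"

fun direct :: "('v, 'e) gpoint \<Rightarrow> ('v, 'e) gpoint \<Rightarrow> real set" where
  "direct (Interior e s) (Interior f t) = (if e = f then {\<bar>s - t\<bar>} else {})"
| "direct _ _ = {}"

definition raw_dist ::
    "('v, 'e) pre_digraph \<Rightarrow> ('e \<Rightarrow> real) \<Rightarrow> ('v, 'e) gpoint \<Rightarrow> ('v, 'e) gpoint \<Rightarrow> real" where
  "raw_dist G l x y = Min (direct x y \<union>
     (\<lambda>((u, r), (v, r')). r + vertex_dist G l u v + r') ` (ends G l x \<times> ends G l y))"

text \<open>\<^locale>\<open>Metric_space\<close> wants nonnegativity also off the carrier, where \<^const>\<open>raw_dist\<close> may fail it.\<close>

definition path_dist ::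
    "('v, 'e) pre_digraph \<Rightarrow> ('e \<Rightarrow> real) \<Rightarrow> ('v, 'e) gpoint \<Rightarrow> ('v, 'e) gpoint \<Rightarrow> real" where
  "path_dist G l x y = (if x \<in> points G l \<and> y \<in> points G l then raw_dist G l x y else 0)"

abbreviation realization ::
    "('v, 'e) pre_digraph \<Rightarrow> ('e \<Rightarrow> real) \<Rightarrow> ('v, 'e) gpoint topology" where
  "realization G l \<equiv> Metric_space.mtopology (points G l) (path_dist G l)"

text \<open>The wedge of \<open>n\<close> circles.\<close>

definition rose :: "nat \<Rightarrow> (nat, nat) pre_digraph" where
  "rose n = \<lparr> verts = {0}, arcs = {..<n}, tail = (\<lambda>_. 0), head = (\<lambda>_. 0) \<rparr>"

abbreviation wedge_of_circles :: "nat \<Rightarrow> (nat, nat) gpoint topology" where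
  "wedge_of_circles n \<equiv> realization (rose n) (\<lambda>_. 1)"

text \<open>
  Finite graphs can be labelled by natural numbers, so every isometry class has a representative
  in the following set. Isometric representatives are not identified; the distance
  below depends only on the isometry classes.
\<close>

definition moduli_space :: "nat \<Rightarrow> ((nat, nat) pre_digraph \<times> (nat \<Rightarrow> real)) set" where
  "moduli_space n = {(G, l). metric_graph G l
     \<and> realization G l homotopy_equivalent_space wedge_of_circles n
     \<and> (\<forall>v\<in>verts G. 3 \<le> valence G v)
     \<and> volume G l = real n}"

text \<open>
  A loop is a nonempty closed edge path without backtracking; these are the essential closed
  edge paths up to homotopy, and every shortest essential closed curve is one of them.
\<close>

definition is_loop :: "('v, 'e) pre_digraph \<Rightarrow> ('e \<times> bool) list \<Rightarrow> bool" where
  "is_loop G p \<longleftrightarrow> p \<noteq> [] \<and> (\<exists>u. edge_path G u p u)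
     \<and> successively (\<lambda>(e, b) (e', b'). \<not> (e' = e \<and> b' \<noteq> b)) p"

definition thick_part :: "nat \<Rightarrow> real \<Rightarrow> ((nat, nat) pre_digraph \<times> (nat \<Rightarrow> real)) set" where
  "thick_part n \<epsilon> = {(G, l) \<in> moduli_space n. \<forall>p. is_loop G p \<longrightarrow> \<epsilon> \<le> path_length l p}"

definition homotopy_equivalence_map :: "'a topology \<Rightarrow> 'b topology \<Rightarrow> ('a \<Rightarrow> 'b) \<Rightarrow> bool" where
  "homotopy_equivalence_map X Y f \<longleftrightarrow> continuous_map X Y f \<and>
     (\<exists>g. continuous_map Y X g
        \<and> homotopic_with (\<lambda>_. True) X X (g \<circ> f) id
        \<and> homotopic_with (\<lambda>_. True) Y Y (f \<circ> g) id)"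

definition lipschitz_map ::
    "real \<Rightarrow> 'a set \<Rightarrow> ('a \<Rightarrow> 'a \<Rightarrow> real) \<Rightarrow> 'b set \<Rightarrow> ('b \<Rightarrow> 'b \<Rightarrow> real) \<Rightarrow> ('a \<Rightarrow> 'b) \<Rightarrow> bool" where
  "lipschitz_map L M d M' d' f \<longleftrightarrow>
     f \<in> M \<rightarrow> M' \<and> (\<forall>x\<in>M. \<forall>y\<in>M. d' (f x) (f y) \<le> L * d x y)"

text \<open>
  The maps are homotopy equivalences, i.e. maps homotopic to a change of marking for some markings
  of the two graphs. For rank at least 1 such a map is not constant, so \<open>0 < L\<close> excludes nothing; it
  is there because \<open>ln 0 = 0\<close>.
\<close>

definition lipschitz_dist ::
    "(nat, nat) pre_digraph \<times> (nat \<Rightarrow> real) \<Rightarrow> (nat, nat) pre_digraph \<times> (nat \<Rightarrow> real) \<Rightarrow> ereal" where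
  "lipschitz_dist = (\<lambda>(G, l) (H, m).
     Inf {ereal (ln L) | L f. 0 < L
       \<and> homotopy_equivalence_map (realization G l) (realization H m) f
       \<and> lipschitz_map L (points G l) (path_dist G l) (points H m) (path_dist H m) f})"

definition lipschitz_diam :: "((nat, nat) pre_digraph \<times> (nat \<Rightarrow> real)) set \<Rightarrow> ereal" where
  "lipschitz_diam X = (SUP (x, y)\<in>X \<times> X. lipschitz_dist x y)"


subsection \<open>The path metric is a metric\<close>

lemma oriented_simps [simp]:
  "verts (oriented G) = verts G" "arcs (oriented G) = arcs G \<times> UNIV"
  "tail (oriented G) (e, b) = (if b then tail G e else head G e)"
  "head (oriented G) (e, b) = (if b then head G e else tail G e)"
  by (simp_all add: oriented_def)

lemma path_length_simps [simp]:
  "path_length l [] = 0" "path_length l (a # p) = l (fst a) + path_length l p"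
  "path_length l (p @ q) = path_length l p + path_length l q"
  by (simp_all add: path_length_def case_prod_beta)

context
  fixes G :: "('v, 'e) pre_digraph" and l :: "'e \<Rightarrow> real"
  assumes mg: "metric_graph G l"
begin

lemma wf_oriented: "wf_digraph (oriented G)"
proof -
  interpret fin_digraph G using mg by (simp add: metric_graph_def)
  show ?thesis by unfold_locales (auto split: if_splits)
qed

interpretation O: wf_digraph "oriented G" by (rule wf_oriented)

lemma path_length_nonneg: "edge_path G u p v \<Longrightarrow> 0 \<le> path_length l p"
proof (induction p arbitrary: u)
  case (Cons a p)
  then show ?case using mg
    by (cases a) (force simp: O.awalk_Cons_iff metric_graph_def intro!: add_nonneg_nonneg)
qed simp

lemma path_bdd_below: "bdd_below {path_length l p | p. edge_path G u p v}"
  using path_length_nonneg by (intro bdd_belowI[of _ 0]) auto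

lemma path_exists:
  assumes "u \<in> verts G" "v \<in> verts G" shows "\<exists>p. edge_path G u p v"
  using mg assms unfolding metric_graph_def strongly_connected_def
  by (auto simp: O.reachable_awalk)

lemma vertex_dist_le: "edge_path G u p v \<Longrightarrow> vertex_dist G l u v \<le> path_length l p"
  unfolding vertex_dist_def by (rule cInf_lower[OF _ path_bdd_below]) auto

lemma vertex_dist_nonneg:
  assumes "u \<in> verts G" "v \<in> verts G" shows "0 \<le> vertex_dist G l u v"
  unfolding vertex_dist_def using path_exists[OF assms] path_length_nonneg
  by (intro cInf_greatest) auto

lemma vertex_dist_refl: "u \<in> verts G \<Longrightarrow> vertex_dist G l u u = 0"
  using vertex_dist_le[of u "[]" u] vertex_dist_nonneg[of u u] by (simp add: O.awalk_Nil_iff)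

lemma path_reverse:
  "edge_path G u p v \<Longrightarrow> \<exists>q. edge_path G v q u \<and> path_length l q = path_length l p"
proof (induction p arbitrary: u)
  case Nil
  then show ?case by (intro exI[of _ "[]"]) (auto simp: O.awalk_Nil_iff)
next
  case (Cons a p)
  obtain e b where a: "a = (e, b)" by (cases a)
  have 1: "e \<in> arcs G" "tail (oriented G) a = u" "edge_path G (head (oriented G) a) p v"
    using Cons.prems a by (auto simp: O.awalk_Cons_iff)
  obtain q where q: "edge_path G v q (head (oriented G) a)" "path_length l q = path_length l p"
    using Cons.IH[OF 1(3)] by blast
  have "u \<in> verts G" using Cons.prems by (auto simp: O.awalk_def)
  then have "edge_path G (head (oriented G) a) [(e, \<not> b)] u"
    using 1 a O.awalk_hd_in_verts[OF 1(3)] by (auto simp: O.awalk_Cons_iff O.awalk_Nil_iff)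
  then have "edge_path G v (q @ [(e, \<not> b)]) u" using q(1) by (rule O.awalk_appendI[rotated])
  then show ?case using q a by (intro exI[of _ "q @ [(e, \<not> b)]"]) (simp del: O.awalk_append_iff)
qed

lemma vertex_dist_commute: "vertex_dist G l u v = vertex_dist G l v u"
proof -
  have "{path_length l p | p. edge_path G u p v} = {path_length l p | p. edge_path G v p u}"
    by (auto; metis path_reverse)
  then show ?thesis by (simp add: vertex_dist_def)
qed

lemma vertex_dist_triangle:
  assumes "u \<in> verts G" "v \<in> verts G" "w \<in> verts G"
  shows "vertex_dist G l u w \<le> vertex_dist G l u v + vertex_dist G l v w"
proof -
  have A: "vertex_dist G l u w \<le> path_length l p + path_length l q"
    if "edge_path G u p v" "edge_path G v q w" for p q
    using vertex_dist_le[OF O.awalk_appendI[OF that]] by simp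
  have B: "vertex_dist G l u w - path_length l p \<le> vertex_dist G l v w" if "edge_path G u p v" for p
    unfolding vertex_dist_def[of _ _ v w] using path_exists[OF assms(2,3)] A[OF that]
    by (intro cInf_greatest) (auto simp: algebra_simps)
  have "vertex_dist G l u w - vertex_dist G l v w \<le> vertex_dist G l u v"
    unfolding vertex_dist_def[of _ _ u v] using path_exists[OF assms(1,2)] B
    by (intro cInf_greatest) (auto simp: algebra_simps)
  then show ?thesis by simp
qed

lemma vertex_dist_pos:
  assumes "u \<in> verts G" "v \<in> verts G" "u \<noteq> v" shows "0 < vertex_dist G l u v"
proof -
  interpret F: fin_digraph G using mg by (simp add: metric_graph_def)
  have len: "\<And>e. e \<in> arcs G \<Longrightarrow> 0 < l e" using mg by (simp add: metric_graph_def)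
  define c where "c = Min (insert 1 (l ` arcs G))"
  have c: "0 < c" "\<And>e. e \<in> arcs G \<Longrightarrow> c \<le> l e" using len by (auto simp: c_def)
  have "c \<le> path_length l p" if p: "edge_path G u p v" for p
  proof (cases p)
    case Nil
    then show ?thesis using p assms by (simp add: O.awalk_Nil_iff)
  next
    case (Cons a q)
    then have "fst a \<in> arcs G" "edge_path G (head (oriented G) a) q v"
      using p by (auto simp: O.awalk_Cons_iff)
    then show ?thesis using Cons c(2)[of "fst a"] path_length_nonneg by fastforce
  qed
  then have "c \<le> vertex_dist G l u v"
    unfolding vertex_dist_def using path_exists[OF assms(1,2)] by (intro cInf_greatest) auto
  then show ?thesis using c by simp
qed

lemma vertex_dist_edge: "e \<in> arcs G \<Longrightarrow> vertex_dist G l (tail G e) (head G e) \<le> l e"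
proof -
  assume e: "e \<in> arcs G"
  interpret F: fin_digraph G using mg by (simp add: metric_graph_def)
  have "edge_path G (tail G e) [(e, True)] (head G e)"
    using e by (simp add: O.awalk_Cons_iff O.awalk_Nil_iff)
  from vertex_dist_le[OF this] show ?thesis by simp
qed

lemma ends_verts:
  assumes "x \<in> points G l" "(u, r) \<in> ends G l x" shows "u \<in> verts G" "0 \<le> r"
proof -
  interpret F: fin_digraph G using mg by (simp add: metric_graph_def)
  show "u \<in> verts G" "0 \<le> r" using assms by (auto simp: points_def)
qed

lemma finite_routes: "finite (direct x y \<union>
     (\<lambda>((u, r), (v, r')). r + vertex_dist G l u v + r') ` (ends G l x \<times> ends G l y))"
  by (cases x; cases y) auto

lemma raw_dist_route:
  "(u, r) \<in> ends G l x \<Longrightarrow> (v, r') \<in> ends G l y \<Longrightarrow>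
     raw_dist G l x y \<le> r + vertex_dist G l u v + r'"
  unfolding raw_dist_def by (rule Min_le[OF finite_routes]) force

lemma raw_dist_direct: "raw_dist G l (Interior e s) (Interior e t) \<le> \<bar>s - t\<bar>"
  unfolding raw_dist_def by (rule Min_le[OF finite_routes]) auto

lemma raw_dist_cases:
  obtains (direct) e s t where "x = Interior e s" "y = Interior e t" "raw_dist G l x y = \<bar>s - t\<bar>"
  | (route) u r v r' where "(u, r) \<in> ends G l x" "(v, r') \<in> ends G l y"
      "raw_dist G l x y = r + vertex_dist G l u v + r'"
proof -
  have "raw_dist G l x y \<in> direct x y \<union>
     (\<lambda>((u, r), (v, r')). r + vertex_dist G l u v + r') ` (ends G l x \<times> ends G l y)"
    unfolding raw_dist_def by (rule Min_in[OF finite_routes]) (cases x; cases y; auto)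
  then consider "raw_dist G l x y \<in> direct x y"
    | u r v r' where "(u, r) \<in> ends G l x" "(v, r') \<in> ends G l y"
      "raw_dist G l x y = r + vertex_dist G l u v + r'" by auto
  then show thesis
  proof cases
    case 1
    then show ?thesis using direct by (cases x; cases y) (auto split: if_splits)
  qed (rule route)
qed

lemma ends_move:
  assumes "(u, r) \<in> ends G l (Interior e t)"
  shows "\<exists>r'. (u, r') \<in> ends G l (Interior e s) \<and> r' \<le> r + \<bar>s - t\<bar>"
  using assms by auto

lemma ends_same:
  assumes y: "y \<in> points G l" and "(u, r) \<in> ends G l y" "(v, r') \<in> ends G l y"
  shows "vertex_dist G l u v \<le> r + r'"
proof (cases y)
  case (Vertex w)
  then show ?thesis using assms by (auto simp: points_def vertex_dist_refl)
next
  case (Interior e t)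
  then have e: "e \<in> arcs G" "0 < t" "t < l e" using y by (auto simp: points_def)
  interpret F: fin_digraph G using mg by (simp add: metric_graph_def)
  have "vertex_dist G l (head G e) (tail G e) \<le> l e"
    using vertex_dist_edge[OF e(1)] vertex_dist_commute[of "head G e" "tail G e"] by simp
  then show ?thesis using assms Interior e vertex_dist_edge[OF e(1)]
    by (auto simp: vertex_dist_refl)
qed

lemma raw_dist_commute_le: "raw_dist G l x y \<le> raw_dist G l y x"
proof (cases rule: raw_dist_cases[of y x])
  case (direct e s t)
  then show ?thesis using raw_dist_direct[of e t s] by simp
next
  case (route u r v r')
  then show ?thesis using raw_dist_route[of v r' x u r y] by (simp add: vertex_dist_commute[of u v])
qed

lemma raw_dist_triangle:
  assumes x: "x \<in> points G l" and y: "y \<in> points G l" and z: "z \<in> points G l"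
  shows "raw_dist G l x z \<le> raw_dist G l x y + raw_dist G l y z"
proof (cases rule: raw_dist_cases[of x y])
  case xy: (direct e s t)
  show ?thesis
  proof (cases rule: raw_dist_cases[of y z])
    case yz: (direct e' s' t')
    then show ?thesis using xy raw_dist_direct[of e s t'] by auto
  next
    case yz: (route u r v r')
    obtain r2 where "(u, r2) \<in> ends G l x" "r2 \<le> r + \<bar>s - t\<bar>"
      using ends_move yz(1) xy by blast
    then show ?thesis using raw_dist_route[of u r2 x v r' z] xy yz by simp
  qed
next
  case xy: (route u r v r')
  show ?thesis
  proof (cases rule: raw_dist_cases[of y z])
    case yz: (direct e s t)
    obtain r2 where "(v, r2) \<in> ends G l z" "r2 \<le> r' + \<bar>t - s\<bar>"
      using ends_move xy(2) yz by blast
    then show ?thesis using raw_dist_route[of u r x v r2 z] xy yz by simp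
  next
    case yz: (route v2 r2 w r3)
    note V = ends_verts(1)[OF x xy(1)] ends_verts(1)[OF y xy(2)]
      ends_verts(1)[OF y yz(1)] ends_verts(1)[OF z yz(2)]
    have "vertex_dist G l u w \<le> vertex_dist G l u v + (vertex_dist G l v v2 + vertex_dist G l v2 w)"
      using vertex_dist_triangle[of u v w] vertex_dist_triangle[of v v2 w] V by simp
    moreover have "vertex_dist G l v v2 \<le> r' + r2" using ends_same[OF y xy(2) yz(1)] .
    ultimately show ?thesis using raw_dist_route[OF xy(1) yz(2)] xy yz by simp
  qed
qed

lemma raw_dist_nonneg:
  assumes "x \<in> points G l" "y \<in> points G l" shows "0 \<le> raw_dist G l x y"
proof (cases rule: raw_dist_cases[of x y])
  case (route u r v r')
  then show ?thesis using ends_verts assms vertex_dist_nonneg by simp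
qed simp

lemma raw_dist_zero:
  assumes x: "x \<in> points G l" and y: "y \<in> points G l"
  shows "raw_dist G l x y = 0 \<longleftrightarrow> x = y"
proof
  assume 0: "raw_dist G l x y = 0"
  show "x = y"
  proof (cases rule: raw_dist_cases[of x y])
    case (direct e s t)
    then show ?thesis using 0 by simp
  next
    case (route u r v r')
    note V = ends_verts[OF x route(1)] ends_verts[OF y route(2)]
    have "r = 0" "r' = 0" "vertex_dist G l u v = 0"
      using V vertex_dist_nonneg[of u v] route 0 by auto
    moreover from this have "u = v" using vertex_dist_pos[of u v] V by auto
    ultimately show ?thesis using route x y by (cases x; cases y) (auto simp: points_def)
  qed
next
  assume "x = y"
  have "raw_dist G l x x \<le> 0"
  proof (cases x)
    case (Vertex v)
    then show ?thesis using x raw_dist_route[of v 0 x v 0 x]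
      by (auto simp: points_def vertex_dist_refl)
  next
    case (Interior e t)
    then show ?thesis using raw_dist_direct[of e t t] by simp
  qed
  then show "raw_dist G l x y = 0" using raw_dist_nonneg[OF x x] \<open>x = y\<close> by simp
qed

lemma Metric_space_path_dist: "Metric_space (points G l) (path_dist G l)"
proof
  show "0 \<le> path_dist G l x y" for x y
    using raw_dist_nonneg by (simp add: path_dist_def)
  show "path_dist G l x y = path_dist G l y x" for x y
    using raw_dist_commute_le by (auto simp: path_dist_def intro: order_antisym)
qed (use raw_dist_zero raw_dist_triangle in \<open>auto simp: path_dist_def\<close>)

end

subsection \<open>The thick part is nonempty\<close>

lemma rose_thick:
  assumes "2 \<le> n" "\<epsilon> \<le> 1" shows "(rose n, \<lambda>_. 1) \<in> thick_part n \<epsilon>"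
proof -
  have [simp]: "finite (arcs (rose n))" by (simp add: rose_def)
  have "in_arcs (rose n) 0 = {..<n}" "out_arcs (rose n) 0 = {..<n}"
    by (auto simp: in_arcs_def out_arcs_def rose_def)
  then have "3 \<le> valence (rose n) 0"
    using assms by (simp add: valence_def in_degree_def out_degree_def)
  moreover have "wf_digraph (oriented (rose n))" "fin_digraph (rose n)"
    by (unfold_locales; auto simp: rose_def)+
  moreover have "path_length (\<lambda>_. 1) p = real (length p)" for p :: "(nat \<times> bool) list"
    by (induction p) auto
  moreover have "strongly_connected (oriented (rose n))"
    by (auto simp: strongly_connected_def rose_def reachable_def rtrancl_on_refl)
  moreover have "1 \<le> length p" if "is_loop (rose n) p" for p
    using that by (cases p) (auto simp: is_loop_def)
  ultimately show ?thesis using assms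
    by (force simp: thick_part_def moduli_space_def metric_graph_def volume_def
        homotopy_equivalent_space_refl rose_def)
qed

end

theory Submission
  imports Defs "HOL-Complex_Analysis.Riemann_Mapping"
begin

text \<open>
  Upper bound: collapse a spanning tree of \<open>G\<close> of minimal length. An edge outside it is the longest
  edge of a cycle with at most \<open>2n\<close> edges, so it has length at least \<open>\<epsilon> / 2n\<close>, and the collapse to the
  rose is \<open>2n / \<epsilon>\<close>-Lipschitz. Conversely the rose maps to \<open>H\<close> by sending each petal around a
  fundamental cycle through the root of a spanning tree, which is \<open>3n\<close>-Lipschitz. Both maps are
  homotopy equivalences; that the two roses have the same rank \<open>n\<close> follows by comparing parities of
  winding numbers of maps to the punctured plane.

  Lower bound: if \<open>G\<close> has a loop of length \<open>\<epsilon>\<close> and \<open>H\<close> is the unit rose, then the image of the loop is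
  essential and cannot be short, so \<open>L \<ge> 1 / 4\<epsilon>\<close>. A homotopy equivalence hits every point of a loop
  edge; applied to a theta graph of diameter less than 1 and a chain of circles with loops at its ends
  at distance \<open>n / 2\<close>, this gives \<open>L \<ge> (n + 1) / 2\<close>.
\<close>

subsection \<open>Maps out of a metric graph\<close>

text \<open>Fundamental groups are replaced by the winding number, along a closed path, of a map to
  the punctured plane: it depends only on the homotopy class of the map, and \<open>wrap l e\<close>
  has winding number 1 along a loop \<open>e\<close>. If \<open>f\<close> has the homotopy inverse
  \<open>g\<close>, this survives composition with \<open>f \<circ> g\<close> or
  \<open>g \<circ> f\<close>, so \<open>f\<close> can neither miss a point of a loop nor keep the
  image of a loop away from one and the same segment of all petals. For the upper bound, no marking
  has to be preserved, so all distances can be estimated through one unit rose. The obstacle is that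
  \<open>moduli_space\<close> fixes a homotopy type, whereas collapsing a tree gives a rose with as
  many petals as there are edges outside the tree. Invariance of the rank turns this number into
  \<open>n\<close>, and then the valence condition bounds the number of vertices. Two lower bounds
  are combined because one grows only with \<open>n\<close> and the other only with
  \<open>1 / \<epsilon>\<close>.\<close>

lemma continuous_map_finite_compact_cover:
  assumes "finite P" and K: "compact_space K" and Z: "Hausdorff_space Z"
    and cont: "\<And>p. p \<in> P \<Longrightarrow> continuous_map K Z p"
    and cover: "topspace Z \<subseteq> (\<Union>p\<in>P. p ` topspace K)"
    and comp: "\<And>p. p \<in> P \<Longrightarrow> continuous_map K Y (F \<circ> p)"
  shows "continuous_map Z Y F"
  unfolding continuous_map_closedin
proof (intro conjI allI impI)
  show "F \<in> topspace Z \<rightarrow> topspace Y"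
  proof
    fix z assume "z \<in> topspace Z"
    then obtain p x where "p \<in> P" "x \<in> topspace K" "z = p x" using cover by blast
    then show "F z \<in> topspace Y" using comp[of p] by (auto simp: continuous_map_def)
  qed
  fix C assume C: "closedin Y C"
  have eq: "{z \<in> topspace Z. F z \<in> C} = (\<Union>p\<in>P. p ` {x \<in> topspace K. (F \<circ> p) x \<in> C})"
    using cover cont by (fastforce simp: continuous_map_def)
  \<comment> \<open>Closed subsets of the compact \<open>K\<close> have compact images, which are
    closed because \<open>Z\<close> is Hausdorff; finitely many of them make up the preimage of
    \<open>C\<close>.\<close>
  have "closedin Z (p ` {x \<in> topspace K. (F \<circ> p) x \<in> C})" if "p \<in> P" for p
  proof -
    have "closedin K {x \<in> topspace K. (F \<circ> p) x \<in> C}"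
      using comp[OF that] C by (simp only: continuous_map_closedin)
    then have "compactin K {x \<in> topspace K. (F \<circ> p) x \<in> C}"
      using K closedin_compact_space by blast
    then show ?thesis
      using cont[OF that] Z by (metis image_compactin compactin_imp_closedin)
  qed
  then show "closedin Z {z \<in> topspace Z. F z \<in> C}"
    unfolding eq using assms(1) by (intro closedin_Union) auto
qed

lemma lipschitz_map_continuous:
  assumes "Metric_space M d" "Metric_space M' d'" "lipschitz_map L M d M' d' f"
  shows "continuous_map (Metric_space.mtopology M d) (Metric_space.mtopology M' d') f"
proof -
  interpret Metric_space M d by fact
  have pos: "\<exists>\<delta>>0. \<forall>x. x \<in> M \<and> d a x < \<delta> \<longrightarrow> d' (f a) (f x) < \<epsilon>" if "a \<in> M" "\<epsilon> > 0" for a \<epsilon>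
  \<comment> \<open>\<open>\<bar>L\<bar> + 1\<close> is a positive bound even if \<open>L\<close> is
    zero or negative.\<close>
  proof (intro exI[of _ "\<epsilon> / (\<bar>L\<bar> + 1)"] conjI allI impI)
    show "0 < \<epsilon> / (\<bar>L\<bar> + 1)" using that by simp
    fix x assume x: "x \<in> M \<and> d a x < \<epsilon> / (\<bar>L\<bar> + 1)"
    have "d' (f a) (f x) \<le> L * d a x" using assms(3) that x by (simp add: lipschitz_map_def)
    also have "\<dots> \<le> (\<bar>L\<bar> + 1) * d a x" by (intro mult_right_mono) auto
    also have "\<dots> < \<epsilon>" using x by (simp add: field_simps)
    finally show "d' (f a) (f x) < \<epsilon>" .
  qed
  show ?thesis
    unfolding metric_continuous_map[OF assms(2)]
    using assms(3) pos by (auto simp: lipschitz_map_def)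
qed

lemma lipschitz_map_comp:
  assumes "lipschitz_map L M d M' d' f" "lipschitz_map L' M' d' M'' d'' g" "0 \<le> L'"
  shows "lipschitz_map (L' * L) M d M'' d'' (g \<circ> f)"
  unfolding lipschitz_map_def
proof (intro conjI ballI)
  show "g \<circ> f \<in> M \<rightarrow> M''" using assms by (auto simp: lipschitz_map_def)
  fix x y assume xy: "x \<in> M" "y \<in> M"
  then have "d'' (g (f x)) (g (f y)) \<le> L' * d' (f x) (f y)"
    using assms unfolding lipschitz_map_def by blast
  also have "\<dots> \<le> L' * (L * d x y)"
    using assms xy by (intro mult_left_mono) (auto simp: lipschitz_map_def)
  finally show "d'' ((g \<circ> f) x) ((g \<circ> f) y) \<le> L' * L * d x y" by (simp add: algebra_simps)
qed

lemma homotopy_equivalence_map_comp: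
  assumes "homotopy_equivalence_map X Y f" "homotopy_equivalence_map Y Z g"
  shows "homotopy_equivalence_map X Z (g \<circ> f)"
proof -
  obtain f' where f: "continuous_map X Y f" "continuous_map Y X f'"
     "homotopic_with (\<lambda>_. True) X X (f' \<circ> f) id" "homotopic_with (\<lambda>_. True) Y Y (f \<circ> f') id"
    using assms(1) unfolding homotopy_equivalence_map_def by blast
  obtain g' where g: "continuous_map Y Z g" "continuous_map Z Y g'"
     "homotopic_with (\<lambda>_. True) Y Y (g' \<circ> g) id" "homotopic_with (\<lambda>_. True) Z Z (g \<circ> g') id"
    using assms(2) unfolding homotopy_equivalence_map_def by blast
  have "homotopic_with (\<lambda>_. True) X X (f' \<circ> ((g' \<circ> g) \<circ> f)) (f' \<circ> (id \<circ> f))"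
    by (intro homotopic_with_compose_continuous_map_left[OF _ f(2)]
        homotopic_with_compose_continuous_map_right[OF g(3) f(1)]) auto
  then have 1: "homotopic_with (\<lambda>_. True) X X (f' \<circ> g' \<circ> (g \<circ> f)) id"
    using f(3) by (auto simp: o_assoc intro: homotopic_with_trans)
  have "homotopic_with (\<lambda>_. True) Z Z (g \<circ> ((f \<circ> f') \<circ> g')) (g \<circ> (id \<circ> g'))"
    by (intro homotopic_with_compose_continuous_map_left[OF _ g(1)]
        homotopic_with_compose_continuous_map_right[OF f(4) g(2)]) auto
  then have 2: "homotopic_with (\<lambda>_. True) Z Z (g \<circ> f \<circ> (f' \<circ> g')) id"
    using g(4) by (auto simp: o_assoc intro: homotopic_with_trans)
  show ?thesis
    unfolding homotopy_equivalence_map_def using 1 2 f(1,2) g(1,2)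
    by (meson continuous_map_compose)
qed

text \<open>Clamping gives a path defined on all reals, so that a reparametrization may run past an
  end of the edge and wait there.\<close>

definition edge_pt :: "('v, 'e) pre_digraph \<Rightarrow> ('e \<Rightarrow> real) \<Rightarrow> 'e \<Rightarrow> real \<Rightarrow> ('v, 'e) gpoint" where
  "edge_pt G l e t =
     (if t \<le> 0 then Vertex (tail G e) else if l e \<le> t then Vertex (head G e) else Interior e t)"

section \<open>Lipschitz bounds and continuity checked edge by edge\<close>

locale mgraph =
  fixes G :: "('v, 'e) pre_digraph" and l :: "'e \<Rightarrow> real"
  assumes mg: "metric_graph G l"
begin

sublocale fin_digraph G using mg by (simp add: metric_graph_def)
sublocale M: Metric_space "points G l" "path_dist G l" by (rule Metric_space_path_dist[OF mg])
sublocale O: wf_digraph "oriented G" by (rule wf_oriented[OF mg])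

abbreviation "X \<equiv> realization G l"

lemma len_pos: "e \<in> arcs G \<Longrightarrow> 0 < l e" using mg by (simp add: metric_graph_def)

lemma edge_pt_in [simp]: "e \<in> arcs G \<Longrightarrow> edge_pt G l e t \<in> points G l"
  by (auto simp: edge_pt_def points_def)

lemma Vertex_in [simp]: "Vertex v \<in> points G l \<longleftrightarrow> v \<in> verts G"
  by (auto simp: points_def)

lemma Interior_in [simp]: "Interior e t \<in> points G l \<longleftrightarrow> e \<in> arcs G \<and> 0 < t \<and> t < l e"
  by (auto simp: points_def)

lemma edge_pt_ends:
  assumes "e \<in> arcs G"
  shows "edge_pt G l e 0 = Vertex (tail G e)" "edge_pt G l e (l e) = Vertex (head G e)"
  using len_pos[OF assms] by (auto simp: edge_pt_def)

lemma edge_pt_route: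
  assumes "e \<in> arcs G" "0 \<le> t" "t \<le> l e"
  shows "path_dist G l (Vertex (tail G e)) (edge_pt G l e t) \<le> t"
    and "path_dist G l (edge_pt G l e t) (Vertex (head G e)) \<le> l e - t"
proof -
  note V = assms(1) len_pos[OF assms(1)] vertex_dist_edge[OF mg assms(1)] vertex_dist_refl[OF mg]
  have p: "path_dist G l (edge_pt G l e s) (edge_pt G l e t) = raw_dist G l (edge_pt G l e s) (edge_pt G l e t)" for s t
    using assms by (simp add: path_dist_def)
  have "path_dist G l (edge_pt G l e 0) (edge_pt G l e t) \<le> t"
    unfolding p
    using V assms raw_dist_route[OF mg, of "tail G e" 0 "Vertex (tail G e)" "tail G e" t "Interior e t"]
     raw_dist_route[OF mg, of "tail G e" 0 "Vertex (tail G e)" "tail G e" 0 "Vertex (tail G e)"]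
     raw_dist_route[OF mg, of "tail G e" 0 "Vertex (tail G e)" "head G e" 0 "Vertex (head G e)"]
    by (auto simp: edge_pt_def)
  then show "path_dist G l (Vertex (tail G e)) (edge_pt G l e t) \<le> t"
    using edge_pt_ends[OF assms(1)] by simp
  have "path_dist G l (edge_pt G l e t) (edge_pt G l e (l e)) \<le> l e - t"
    unfolding p
    using V assms raw_dist_route[OF mg, of "head G e" "l e - t" "Interior e t" "head G e" 0 "Vertex (head G e)"]
     raw_dist_route[OF mg, of "head G e" 0 "Vertex (head G e)" "head G e" 0 "Vertex (head G e)"]
     raw_dist_route[OF mg, of "tail G e" 0 "Vertex (tail G e)" "head G e" 0 "Vertex (head G e)"]
    by (auto simp: edge_pt_def)
  then show "path_dist G l (edge_pt G l e t) (Vertex (head G e)) \<le> l e - t"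
    using edge_pt_ends[OF assms(1)] by simp
qed

lemma edge_pt_lipschitz:
  assumes e: "e \<in> arcs G"
  shows "path_dist G l (edge_pt G l e s) (edge_pt G l e t) \<le> \<bar>s - t\<bar>"
proof -
  \<comment> \<open>Clamping a parameter to the edge is 1-Lipschitz and leaves
    \<open>edge_pt\<close> unchanged, which reduces the claim to parameters on the edge.\<close>
  define c where "c t = max 0 (min t (l e))" for t
  have cl: "edge_pt G l e (c t) = edge_pt G l e t" "0 \<le> c t" "c t \<le> l e" for t
    using len_pos[OF e] by (auto simp: c_def edge_pt_def max_def min_def)
  have 1: "path_dist G l (edge_pt G l e s) (edge_pt G l e t) \<le> \<bar>s - t\<bar>"
    if "0 \<le> s" "s \<le> l e" "0 \<le> t" "t \<le> l e" for s t
  proof -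
    have "s = 0 \<or> t = 0 \<or> s = l e \<or> t = l e \<or> 0 < s \<and> s < l e \<and> 0 < t \<and> t < l e"
      using that by linarith
    then consider "s = 0" | "t = 0" | "s = l e" | "t = l e" | "0 < s" "s < l e" "0 < t" "t < l e"
      by blast
    then show ?thesis
    proof cases
      case 5
      then show ?thesis using raw_dist_direct[OF mg, of e s t] e
        by (simp add: edge_pt_def path_dist_def)
    next
      case 1
      then show ?thesis using edge_pt_route(1)[OF e, of t] edge_pt_ends[OF e] that by simp
    next
      case 2
      then show ?thesis using edge_pt_route(1)[OF e, of s] edge_pt_ends[OF e] that
        by (simp add: M.commute)
    next
      case 3
      then show ?thesis using edge_pt_route(2)[OF e, of t] edge_pt_ends[OF e] that
        by (simp add: M.commute)
    next
      case 4
      then show ?thesis using edge_pt_route(2)[OF e, of s] edge_pt_ends[OF e] that by simp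
    qed
  qed
  have "\<bar>c s - c t\<bar> \<le> \<bar>s - t\<bar>" by (auto simp: c_def max_def min_def)
  then show ?thesis using 1[OF cl(2,3) cl(2,3), of s t] by (simp add: cl)
qed

lemma edge_pt_surj:
  assumes "x \<in> points G l"
  obtains v where "v \<in> verts G" "x = Vertex v"
  | e t where "e \<in> arcs G" "0 < t" "t < l e" "x = Interior e t" "x = edge_pt G l e t"
  using assms by (auto simp: points_def edge_pt_def)

text \<open>Distances are infima of lengths of edge paths plus two end segments, so a bound on
  single edges adds up along a path and passes to the infimum.\<close>

lemma lipschitz_map_by_edges:
  assumes MS: "Metric_space M' d'" and L: "0 \<le> L"
    and f: "f \<in> points G l \<rightarrow> M'"
    and edge: "\<And>e s t. \<lbrakk>e \<in> arcs G; 0 \<le> s; s \<le> t; t \<le> l e\<rbrakk> \<Longrightarrow>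
       d' (f (edge_pt G l e s)) (f (edge_pt G l e t)) \<le> L * (t - s)"
  shows "lipschitz_map L (points G l) (path_dist G l) M' d' f"
proof -
  interpret M': Metric_space M' d' by fact
  have edge': "d' (f (edge_pt G l e s)) (f (edge_pt G l e t)) \<le> L * \<bar>s - t\<bar>"
    if "e \<in> arcs G" "0 \<le> s" "s \<le> l e" "0 \<le> t" "t \<le> l e" for e s t
    using edge[of e s t] edge[of e t s] that M'.commute
    by (cases s t rule: linorder_cases) auto
  have path: "d' (f (Vertex u)) (f (Vertex v)) \<le> L * path_length l p" if "edge_path G u p v" for u v p
    using that
  proof (induction p arbitrary: u)
    case Nil
    then have "u = v" "f (Vertex v) \<in> M'" using f by (auto simp: O.awalk_Nil_iff)
    then show ?case by simp
  next
    case (Cons a p)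
    obtain e b where a: "a = (e, b)" by (cases a)
    have 1: "e \<in> arcs G" "tail (oriented G) a = u" "edge_path G (head (oriented G) a) p v"
      using Cons.prems a by (auto simp: O.awalk_Cons_iff)
    have V: "u \<in> verts G" "v \<in> verts G" "head (oriented G) a \<in> verts G"
      using O.awalk_last_in_verts[OF Cons.prems] O.awalk_hd_in_verts[OF Cons.prems]
        O.awalk_hd_in_verts[OF 1(3)] by simp_all
    have "d' (f (Vertex u)) (f (Vertex (head (oriented G) a))) \<le> L * l e"
      using edge'[of e 0 "l e"] len_pos[of e] edge_pt_ends[of e] 1 a M'.commute by (cases b) auto
    moreover have "d' (f (Vertex u)) (f (Vertex v)) \<le> d' (f (Vertex u)) (f (Vertex (head (oriented G) a)))
       + d' (f (Vertex (head (oriented G) a))) (f (Vertex v))"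
      using V f by (intro M'.triangle) auto
    ultimately show ?case using Cons.IH[OF 1(3)] a by (simp add: algebra_simps)
  qed
  have vd: "d' (f (Vertex u)) (f (Vertex v)) \<le> L * vertex_dist G l u v"
    if "u \<in> verts G" "v \<in> verts G" for u v
  \<comment> \<open>The comparison with the infimum divides by \<open>L\<close>; for
    \<open>L = 0\<close> a single path suffices.\<close>
  proof (cases "L = 0")
    case True
    then show ?thesis using path_exists[OF mg that] path by fastforce
  next
    case False
    then have "L > 0" using L by simp
    have "d' (f (Vertex u)) (f (Vertex v)) / L \<le> vertex_dist G l u v"
      unfolding vertex_dist_def using path_exists[OF mg that] path \<open>L > 0\<close>
      by (intro cInf_greatest) (auto simp: field_simps)
    then show ?thesis using \<open>L > 0\<close> by (simp add: field_simps)
  qed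
  have ends: "d' (f x) (f (Vertex u)) \<le> L * r" if "x \<in> points G l" "(u, r) \<in> ends G l x" for x u r
    using that(1)
  proof (cases rule: edge_pt_surj)
    case (1 v)
    then have "f (Vertex v) \<in> M'" using f by auto
    then show ?thesis using 1 that by simp
  next
    case (2 e t)
    then show ?thesis using that(2) edge'[of e t 0] edge'[of e t "l e"] edge_pt_ends[of e] by auto
  qed
  have "d' (f x) (f y) \<le> L * raw_dist G l x y" if x: "x \<in> points G l" and y: "y \<in> points G l" for x y
  proof (cases rule: raw_dist_cases[OF mg, of x y, case_names direct route])
    case (direct e s t)
    then have "x = edge_pt G l e s" "y = edge_pt G l e t" "e \<in> arcs G" "0 \<le> s" "s \<le> l e" "0 \<le> t" "t \<le> l e"
      using x y by (auto simp: edge_pt_def)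
    then show ?thesis using edge'[of e s t] direct(3) by simp
  next
    case (route u r v r')
    note V = ends_verts(1)[OF mg x route(1)] ends_verts(1)[OF mg y route(2)]
    have fi: "f x \<in> M'" "f y \<in> M'" "f (Vertex u) \<in> M'" "f (Vertex v) \<in> M'"
      using f x y V by auto
    have "d' (f x) (f y) \<le> d' (f x) (f (Vertex u)) + (d' (f (Vertex u)) (f (Vertex v)) + d' (f (Vertex v)) (f y))"
      using M'.triangle[of "f x" "f (Vertex u)" "f y"] M'.triangle[of "f (Vertex u)" "f (Vertex v)" "f y"] fi by linarith
    also have "\<dots> \<le> L * r + (L * vertex_dist G l u v + L * r')"
      using ends[OF x route(1)] ends[OF y route(2)] vd[OF V] M'.commute[of "f y"] by (intro add_mono) auto
    finally show ?thesis using route(3) by (simp add: algebra_simps)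
  qed
  then show ?thesis using f by (simp add: lipschitz_map_def path_dist_def)
qed

lemma continuous_map_real_lipschitz:
  assumes "\<And>t. f t \<in> points G l" "\<And>s t. path_dist G l (f s) (f t) \<le> L * \<bar>s - t\<bar>"
  shows "continuous_map euclideanreal X f"
  using lipschitz_map_continuous[OF Met_TC.Metric_space_axioms M.Metric_space_axioms, of L f]
  using assms by (simp add: lipschitz_map_def dist_real_def)

lemma continuous_map_edge_pt: "e \<in> arcs G \<Longrightarrow> continuous_map euclideanreal X (edge_pt G l e)"
  using edge_pt_lipschitz by (intro continuous_map_real_lipschitz[where L = 1]) auto

text \<open>The cylinder is covered by one square for each edge and, so that all pieces have the
  same compact domain, one for each vertex whose second coordinate is ignored.\<close>

lemma continuous_map_by_edges_homotopy:
  assumes vert: "\<And>v. v \<in> verts G \<Longrightarrow> continuous_map (top_of_set {0..1}) Y (\<lambda>s. F (s, Vertex v))"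
    and edge: "\<And>e. e \<in> arcs G \<Longrightarrow>
      continuous_map (top_of_set ({0..1} \<times> {0..1})) Y (\<lambda>(s, t). F (s, edge_pt G l e (t * l e)))"
  shows "continuous_map (prod_topology (top_of_set {0..1::real}) X) Y F"
proof (rule continuous_map_finite_compact_cover)
  let ?K = "top_of_set ({0..1::real} \<times> {0..1::real})"
  let ?P = "(\<lambda>v (s, t). (s, Vertex v)) ` verts G \<union> (\<lambda>e (s, t). (s, edge_pt G l e (t * l e))) ` arcs G"
  show "finite ?P" by simp
  show "compact_space ?K" by (simp add: compact_space_subtopology compact_Times)
  show "Hausdorff_space (prod_topology (top_of_set {0..1::real}) X)"
    by (simp add: Hausdorff_space_prod_topology Hausdorff_space_subtopology M.Hausdorff_space_mtopology)
  have c1: "continuous_map ?K (top_of_set {0..1}) fst" by (auto intro!: continuous_intros)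
  have cv: "continuous_map ?K (prod_topology (top_of_set {0..1::real}) X) (\<lambda>(s, t). (s, Vertex v))"
    if "v \<in> verts G" for v
    using that c1 by (simp add: continuous_map_paired case_prod_unfold)
  have c2: "continuous_map ?K euclideanreal (\<lambda>p. snd p * c)" for c
    by (auto intro!: continuous_intros)
  have ce: "continuous_map ?K (prod_topology (top_of_set {0..1::real}) X) (\<lambda>(s, t). (s, edge_pt G l e (t * l e)))"
    if "e \<in> arcs G" for e
    using that c1 continuous_map_compose[OF c2[of "l e"] continuous_map_edge_pt[OF that]] 
    by (simp add: continuous_map_paired case_prod_unfold o_def)
  show "continuous_map ?K (prod_topology (top_of_set {0..1::real}) X) p" if "p \<in> ?P" for p
    using that cv ce by blast
  show "continuous_map ?K Y (F \<circ> p)" if p: "p \<in> ?P" for p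
  proof -
    have "continuous_map ?K Y (F \<circ> (\<lambda>(s, t). (s, Vertex v)))" if "v \<in> verts G" for v
      using continuous_map_compose[OF c1 vert[OF that]] by (simp add: o_def case_prod_unfold)
    moreover have "continuous_map ?K Y (F \<circ> (\<lambda>(s, t). (s, edge_pt G l e (t * l e))))" if "e \<in> arcs G" for e
      using edge[OF that] by (simp add: o_def case_prod_unfold)
    ultimately show ?thesis using p by blast
  qed
  show "topspace (prod_topology (top_of_set {0..1::real}) X) \<subseteq> (\<Union>p\<in>?P. p ` topspace ?K)"
  proof
    fix z assume "z \<in> topspace (prod_topology (top_of_set {0..1::real}) X)"
    then obtain s x where z: "z = (s, x)" "s \<in> {0..1}" "x \<in> points G l" by auto
    from z(3) show "z \<in> (\<Union>p\<in>?P. p ` topspace ?K)"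
    proof (cases rule: edge_pt_surj)
      case (1 v)
      then have "z = (\<lambda>(s, t). (s, Vertex v)) (s, 0::real)" using z by simp
      then show ?thesis using 1 z by fastforce
    next
      case (2 e t)
      then have "z = (\<lambda>(s, t). (s, edge_pt G l e (t * l e))) (s, t / l e)" "(s, t / l e) \<in> topspace ?K"
        using z by (auto simp: field_simps)
      then show ?thesis using 2(1) by blast
    qed
  qed
qed

lemma continuous_map_by_edges:
  assumes vert: "\<And>v. v \<in> verts G \<Longrightarrow> f (Vertex v) \<in> topspace Y"
    and edge: "\<And>e. e \<in> arcs G \<Longrightarrow> continuous_map (top_of_set {0..1}) Y (\<lambda>t. f (edge_pt G l e (t * l e)))"
  shows "continuous_map X Y f"
proof -
  have "continuous_map (prod_topology (top_of_set {0..1::real}) X) Y (f \<circ> snd)"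
  proof (rule continuous_map_by_edges_homotopy)
    fix e assume e: "e \<in> arcs G"
    have "continuous_map (top_of_set ({0..1::real} \<times> {0..1::real})) (top_of_set {0..1}) snd"
      by (auto intro!: continuous_intros)
    from continuous_map_compose[OF this edge[OF e]]
    show "continuous_map (top_of_set ({0..1::real} \<times> {0..1})) Y (\<lambda>(s, t). (f \<circ> snd) (s, edge_pt G l e (t * l e)))"
      by (simp add: o_def case_prod_unfold)
  qed (use vert in simp)
  from continuous_map_compose[OF _ this, of X "\<lambda>x. (0, x)"]
  have "continuous_map X Y ((f \<circ> snd) \<circ> (\<lambda>x. (0, x)))"
    by (simp add: continuous_map_pairwise o_def)
  then show ?thesis by (simp add: o_def)
qed

end

subsection \<open>Roses and rooted spanning trees\<close>

abbreviation unit_rose :: "nat \<Rightarrow> (nat, nat) gpoint topology" where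
  "unit_rose k \<equiv> realization (rose k) (\<lambda>_. 1)"

lemma rose_simps [simp]:
  "verts (rose k) = {0}" "arcs (rose k) = {..<k}" "tail (rose k) i = 0" "head (rose k) i = 0"
  by (simp_all add: rose_def)

lemma mgraph_rose:
  assumes "\<And>i. i < k \<Longrightarrow> 0 < m i"
  shows "mgraph (rose k) m"
proof -
  have "fin_digraph (rose k)" "wf_digraph (oriented (rose k))"
    by (unfold_locales; auto)+
  moreover have "strongly_connected (oriented (rose k))"
    by (auto simp: strongly_connected_def reachable_def rtrancl_on_refl)
  ultimately show ?thesis using assms by (simp add: mgraph_def metric_graph_def)
qed

interpretation R: mgraph "rose k" "\<lambda>_. 1" for k
  by (rule mgraph_rose) simp

text \<open>The homotopy is linear from \<open>\<alpha> i\<close> to the identity on each petal. The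
  conditions at 0 and 1 keep both ends clamped at the base point throughout;
  \<open>\<alpha> i\<close> itself may overshoot.\<close>

lemma rose_reparametrization:
  assumes cont: "\<And>i. i < k \<Longrightarrow> continuous_on {0..1} (\<alpha> i)"
    and ends: "\<And>i. i < k \<Longrightarrow> \<alpha> i 0 \<le> 0" "\<And>i. i < k \<Longrightarrow> 1 \<le> \<alpha> i (1::real)"
    and f0: "f (Vertex 0) = Vertex 0"
    and f: "\<And>i t. \<lbrakk>i < k; 0 < t; t < 1\<rbrakk> \<Longrightarrow> f (Interior i t) = edge_pt (rose k) (\<lambda>_. 1) i (\<alpha> i t)"
  shows "homotopic_with (\<lambda>_. True) (unit_rose k) (unit_rose k) f id"
proof -
  define F where "F = (\<lambda>(s, x). case x of Vertex v \<Rightarrow> Vertex v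
     | Interior i t \<Rightarrow> edge_pt (rose k) (\<lambda>_. 1) i ((1 - s) * \<alpha> i t + s * t))"
  have "continuous_map (prod_topology (top_of_set {0..1}) (unit_rose k)) (unit_rose k) F"
  proof (rule R.continuous_map_by_edges_homotopy)
    fix i assume i: "i \<in> arcs (rose k)"
    have eq: "F (s, edge_pt (rose k) (\<lambda>_. 1) i (t * 1))
        = edge_pt (rose k) (\<lambda>_. 1) i ((1 - s) * \<alpha> i t + s * t)" if "s \<in> {0..1}" "t \<in> {0..1}" for s t
    proof -
      have "(1 - s) * \<alpha> i 0 + s * 0 \<le> 0" using ends(1)[of i] i that
        by (simp add: mult_nonneg_nonpos)
      moreover have "1 \<le> (1 - s) * \<alpha> i 1 + s * 1"
        using mult_left_mono[OF ends(2)[of i], of "1 - s"] i that by simp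
      ultimately show ?thesis using that
        by (cases "t = 0"; cases "t = 1") (auto simp: F_def edge_pt_def)
    qed
    have "continuous_on ({0..1} \<times> {0..1}) (\<lambda>(s, t). (1 - s) * \<alpha> i t + s * t)"
      using i by (auto simp: case_prod_unfold
          intro!: continuous_intros continuous_on_compose2[OF cont[of i]])
    then have "continuous_map (top_of_set ({0..1} \<times> {0..1})) euclideanreal (\<lambda>(s, t). (1 - s) * \<alpha> i t + s * t)"
      by simp
    from continuous_map_compose[OF this R.continuous_map_edge_pt[OF i]]
    show "continuous_map (top_of_set ({0..1} \<times> {0..1})) (unit_rose k)
       (\<lambda>(s, t). F (s, edge_pt (rose k) (\<lambda>_. 1) i (t * 1)))"
      by (rule continuous_map_eq) (use eq in \<open>auto simp: o_def\<close>)
  qed (auto simp: F_def)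
  moreover have "F (0, x) = f x" "F (1, x) = x" if "x \<in> points (rose k) (\<lambda>_. 1)" for x
    using that f f0 by (auto simp: F_def edge_pt_def elim!: R.edge_pt_surj)
  ultimately show ?thesis
    by (subst homotopic_with) (auto intro!: exI[of _ F])
qed

text \<open>Every vertex except the root chooses an edge towards the root, and the depth rules out
  cycles. Paths and inductions then run along \<open>dep\<close>.\<close>

locale rooted_tree = mgraph G l for G :: "('v, 'e) pre_digraph" and l +
  fixes r :: 'v and par :: "'v \<Rightarrow> 'e \<times> bool" and dep :: "'v \<Rightarrow> nat"
  assumes root: "r \<in> verts G" and dep_root: "dep r = 0"
    and par_arc: "\<And>v. \<lbrakk>v \<in> verts G; v \<noteq> r\<rbrakk> \<Longrightarrow> fst (par v) \<in> arcs G"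
    and par_tail: "\<And>v. \<lbrakk>v \<in> verts G; v \<noteq> r\<rbrakk> \<Longrightarrow> tail (oriented G) (par v) = v"
    and par_dep: "\<And>v. \<lbrakk>v \<in> verts G; v \<noteq> r\<rbrakk> \<Longrightarrow> dep v = Suc (dep (head (oriented G) (par v)))"
begin

abbreviation "up v \<equiv> head (oriented G) (par v)"
abbreviation "pe v \<equiv> fst (par v)"
abbreviation "T \<equiv> pe ` (verts G - {r})"

lemma up_in: "\<lbrakk>v \<in> verts G; v \<noteq> r\<rbrakk> \<Longrightarrow> up v \<in> verts G"
  using par_arc[of v] by (cases "par v") auto

lemma par_cases:
  assumes "v \<in> verts G" "v \<noteq> r"
  shows "if snd (par v) then tail G (pe v) = v \<and> head G (pe v) = up v
     else head G (pe v) = v \<and> tail G (pe v) = up v"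
  using par_tail[OF assms] by (cases "par v") auto

lemma T_arcs: "T \<subseteq> arcs G" using par_arc by auto

lemma tree_induct [consumes 1, case_names root step]:
  assumes "v \<in> verts G" "P r" "\<And>v. \<lbrakk>v \<in> verts G; v \<noteq> r; P (up v)\<rbrakk> \<Longrightarrow> P v"
  shows "P v"
  using assms(1)
proof (induction "dep v" arbitrary: v rule: less_induct)
  case less
  then show ?case using assms(2,3) par_dep[of v] up_in[of v] by (cases "v = r") auto
qed

text \<open>Two vertices with the same parent edge would be its two ends and each other's parents,
  against the depths.\<close>

lemma inj_pe: "inj_on pe (verts G - {r})"
proof (rule inj_onI, rule ccontr)
  fix v w assume A: "v \<in> verts G - {r}" "w \<in> verts G - {r}" "pe v = pe w" "v \<noteq> w"
  then have "up v = w" "up w = v"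
    using par_cases[of v] par_cases[of w] by (auto split: if_splits)
  then show False using par_dep[of v] par_dep[of w] A by auto
qed

lemma card_T: "card T = card (verts G) - 1"
  using inj_pe root by (simp add: card_image)

section \<open>Arc-length paths to the root\<close>

definition ori_pt :: "'e \<times> bool \<Rightarrow> real \<Rightarrow> ('v, 'e) gpoint" where
  "ori_pt a t = edge_pt G l (fst a) (if snd a then t else l (fst a) - t)"

text \<open>The first argument is fuel. With fuel \<open>dep v\<close> the path ends at the root,
  and \<open>climb_len\<close> is the length of the tree path; parameters outside that range give
  its ends.\<close>

primrec climb :: "nat \<Rightarrow> 'v \<Rightarrow> real \<Rightarrow> ('v, 'e) gpoint" where
  "climb 0 v t = Vertex v"
| "climb (Suc k) v t = (if t \<le> l (pe v) then ori_pt (par v) t else climb k (up v) (t - l (pe v)))"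

primrec climb_len :: "nat \<Rightarrow> 'v \<Rightarrow> real" where
  "climb_len 0 v = 0"
| "climb_len (Suc k) v = l (pe v) + climb_len k (up v)"

abbreviation "\<sigma> v \<equiv> climb (dep v) v"
abbreviation "D v \<equiv> climb_len (dep v) v"

lemma ori_pt_ends:
  assumes "v \<in> verts G" "v \<noteq> r"
  shows "t \<le> 0 \<Longrightarrow> ori_pt (par v) t = Vertex v" "l (pe v) \<le> t \<Longrightarrow> ori_pt (par v) t = Vertex (up v)"
    "ori_pt (par v) t \<in> points G l"
    "path_dist G l (ori_pt (par v) s) (ori_pt (par v) t) \<le> \<bar>s - t\<bar>"
  using par_cases[OF assms] par_arc[OF assms] len_pos[OF par_arc[OF assms]]
    edge_pt_lipschitz[OF par_arc[OF assms], of s t]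
    edge_pt_lipschitz[OF par_arc[OF assms], of "l (pe v) - s" "l (pe v) - t"]
  by (auto simp: ori_pt_def edge_pt_def split: if_splits)

lemma \<sigma>_root [simp]: "\<sigma> r t = Vertex r" "D r = 0"
  by (simp_all add: dep_root)

lemma \<sigma>_step:
  assumes "v \<in> verts G" "v \<noteq> r"
  shows "\<sigma> v t = (if t \<le> l (pe v) then ori_pt (par v) t else \<sigma> (up v) (t - l (pe v)))"
    "D v = l (pe v) + D (up v)"
  using par_dep[OF assms] by auto

declare climb.simps [simp del] climb_len.simps [simp del]

lemma D_nonneg: "v \<in> verts G \<Longrightarrow> 0 \<le> D v"
proof (induction v rule: tree_induct)
  case (step v)
  then show ?case using \<sigma>_step(2)[of v] len_pos[OF par_arc[of v]] by simp
qed simp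

lemma \<sigma>_start: "\<lbrakk>v \<in> verts G; t \<le> 0\<rbrakk> \<Longrightarrow> \<sigma> v t = Vertex v"
  using \<sigma>_step(1)[of v t] len_pos[OF par_arc[of v]] ori_pt_ends(1)[of v t] by (cases "v = r") auto

lemma \<sigma>_end: "v \<in> verts G \<Longrightarrow> D v \<le> t \<Longrightarrow> \<sigma> v t = Vertex r"
proof (induction v arbitrary: t rule: tree_induct)
  case (step v)
  note V = step(1,2) up_in[OF step(1,2)]
  show ?case
  proof (cases "t \<le> l (pe v)")
    case True
    \<comment> \<open>Here the climb from \<open>up v\<close> has length 0, so its start
      \<open>up v\<close> is also its end \<open>r\<close>.\<close>
    then have "D (up v) \<le> 0" "t = l (pe v)"
      using step.prems \<sigma>_step(2)[OF V(1,2)] D_nonneg[OF V(3)] by auto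
    moreover from this have "up v = r" using step.IH[of 0] \<sigma>_start[OF V(3), of 0] by simp
    ultimately show ?thesis using \<sigma>_step(1)[OF V(1,2), of t] ori_pt_ends(2)[OF V(1,2), of t] by simp
  next
    case False
    then show ?thesis
      using step.IH[of "t - l (pe v)"] step.prems \<sigma>_step[OF V(1,2)] by simp
  qed
qed simp

lemma \<sigma>_shift: "\<lbrakk>v \<in> verts G; v \<noteq> r; 0 \<le> t\<rbrakk> \<Longrightarrow> \<sigma> v (l (pe v) + t) = \<sigma> (up v) t"
  using \<sigma>_step(1)[of v "l (pe v) + t"] ori_pt_ends(2)[of v "l (pe v)"] \<sigma>_start[of "up v" 0] up_in[of v]
  by (cases "t = 0") auto

text \<open>Two pieces of speed at most 1 that agree at \<open>a\<close> are joined by the triangle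
  inequality through the common point.\<close>

lemma path_dist_if_lipschitz:
  assumes "\<And>t. t \<le> a \<Longrightarrow> f t \<in> points G l" "\<And>t. a \<le> t \<Longrightarrow> g t \<in> points G l" "f a = g a"
    "\<And>s t. \<lbrakk>s \<le> t; t \<le> a\<rbrakk> \<Longrightarrow> path_dist G l (f s) (f t) \<le> t - s"
    "\<And>s t. \<lbrakk>a \<le> s; s \<le> t\<rbrakk> \<Longrightarrow> path_dist G l (g s) (g t) \<le> t - s" "s \<le> t"
  shows "path_dist G l (if s \<le> a then f s else g s) (if t \<le> a then f t else g t) \<le> t - (s::real)"
proof -
  have "path_dist G l (f s) (g t) \<le> t - s" if "s \<le> a" "a \<le> t"
    using M.triangle[of "f s" "f a" "g t"] assms(1)[of s] assms(1)[of a] assms(2)[of t] assms(3)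
      assms(4)[of s a] assms(5)[of a t] that by simp
  then show ?thesis using assms(4)[of s t] assms(5)[of s t] \<open>s \<le> t\<close> by auto
qed

lemma \<sigma>_in [simp]: "v \<in> verts G \<Longrightarrow> \<sigma> v t \<in> points G l"
proof (induction v arbitrary: t rule: tree_induct)
  case (step v)
  then show ?case using ori_pt_ends(3)[of v] \<sigma>_step(1)[of v] by simp
qed (simp add: root)

lemma \<sigma>_lipschitz: "v \<in> verts G \<Longrightarrow> s \<le> t \<Longrightarrow> path_dist G l (\<sigma> v s) (\<sigma> v t) \<le> t - s"
proof (induction v arbitrary: s t rule: tree_induct)
  case (step v)
  show ?case unfolding \<sigma>_step(1)[OF step(1,2)]
  proof (rule path_dist_if_lipschitz)
    show "path_dist G l (ori_pt (par v) s) (ori_pt (par v) t) \<le> t - s" if "s \<le> t" for s t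
      using ori_pt_ends(4)[OF step(1,2), of s t] that by simp
    show "ori_pt (par v) (l (pe v)) = \<sigma> (up v) (l (pe v) - l (pe v))"
      using ori_pt_ends(2)[OF step(1,2), of "l (pe v)"] \<sigma>_start[OF up_in[OF step(1,2)], of 0] by simp
    show "path_dist G l (\<sigma> (up v) (s - l (pe v))) (\<sigma> (up v) (t - l (pe v))) \<le> t - s" if "s \<le> t" for s t
      using step.IH[of "s - l (pe v)" "t - l (pe v)"] that by simp
  qed (use step ori_pt_ends(3) up_in in auto)
qed (simp add: root)

text \<open>The induction bounds \<open>D v\<close> by the parent edges of all vertices of depth at
  most \<open>dep v\<close>. Since \<open>v\<close> is deeper than the vertices counted for
  \<open>up v\<close>, its parent edge is new, and \<open>inj_pe\<close> turns the sum over vertices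
  into a sum over edges.\<close>

lemma D_le_volume:
  assumes "v \<in> verts G" shows "D v \<le> volume G l"
proof -
  let ?A = "\<lambda>k. {w \<in> verts G - {r}. dep w \<le> k}"
  have "D v \<le> (\<Sum>w\<in>?A (dep v). l (pe w))" using assms
  proof (induction v rule: tree_induct)
    case root
    show ?case unfolding \<sigma>_root by (intro sum_nonneg) (use len_pos[OF par_arc] in \<open>force intro: less_imp_le\<close>)
  next
    case (step v)
    have "D v \<le> l (pe v) + (\<Sum>w\<in>?A (dep (up v)). l (pe w))" using \<sigma>_step(2)[of v] step by simp
    also have "\<dots> = (\<Sum>w\<in>insert v (?A (dep (up v))). l (pe w))"
      using par_dep[of v] step by simp
    also have "\<dots> \<le> (\<Sum>w\<in>?A (dep v). l (pe w))"
      using par_dep[of v] step len_pos[OF par_arc] by (intro sum_mono2) (auto intro: less_imp_le)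
    finally show ?case .
  qed
  also have "\<dots> \<le> (\<Sum>w\<in>verts G - {r}. l (pe w))"
    using len_pos[OF par_arc] by (intro sum_mono2) (auto intro: less_imp_le)
  also have "\<dots> = sum l T" using sum.reindex[OF inj_pe, of l] by simp
  also have "\<dots> \<le> volume G l"
    unfolding volume_def using T_arcs len_pos by (intro sum_mono2) (auto intro: less_imp_le)
  finally show ?thesis .
qed

text \<open>The path from the root to the tail of \<open>e\<close>, along \<open>e\<close>, and from
  its head back to the root. The parameter is arc length with origin at the tail, so
  \<open>e\<close> occupies the interval from 0 to \<open>l e\<close>.\<close>

definition petal_path :: "'e \<Rightarrow> real \<Rightarrow> ('v, 'e) gpoint" where
  "petal_path e t = (if t \<le> l e then (if t \<le> 0 then \<sigma> (tail G e) (- t) else edge_pt G l e t)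
     else \<sigma> (head G e) (t - l e))"

definition petal_len :: "'e \<Rightarrow> real" where
  "petal_len e = D (tail G e) + l e + D (head G e)"

lemma petal_path_in [simp]: "e \<in> arcs G \<Longrightarrow> petal_path e t \<in> points G l"
  by (simp add: petal_path_def)

lemma petal_path_lipschitz:
  assumes e: "e \<in> arcs G" and "s \<le> t"
  shows "path_dist G l (petal_path e s) (petal_path e t) \<le> t - s"
  unfolding petal_path_def
proof (rule path_dist_if_lipschitz[where f = "\<lambda>t. if t \<le> 0 then \<sigma> (tail G e) (- t) else edge_pt G l e t"])
  show "path_dist G l (if s \<le> 0 then \<sigma> (tail G e) (- s) else edge_pt G l e s)
        (if t \<le> 0 then \<sigma> (tail G e) (- t) else edge_pt G l e t) \<le> t - s" if "s \<le> t" for s t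
  proof (rule path_dist_if_lipschitz[where f = "\<lambda>t. \<sigma> (tail G e) (- t)"])
    show "path_dist G l (\<sigma> (tail G e) (- s)) (\<sigma> (tail G e) (- t)) \<le> t - s" if "s \<le> t" for s t
      using \<sigma>_lipschitz[of "tail G e" "- t" "- s"] e that by (simp add: M.commute)
    show "path_dist G l (edge_pt G l e s) (edge_pt G l e t) \<le> t - s" if "s \<le> t" for s t
      using edge_pt_lipschitz[OF e, of s t] that by simp
  qed (use e that \<sigma>_start[of "tail G e" 0] edge_pt_ends[OF e] in auto)
  show "path_dist G l (\<sigma> (head G e) (s - l e)) (\<sigma> (head G e) (t - l e)) \<le> t - s" if "s \<le> t" for s t
    using \<sigma>_lipschitz[of "head G e" "s - l e" "t - l e"] e that by simp
qed (use assms \<sigma>_start[of "head G e" 0] edge_pt_ends[OF e] len_pos[OF e] in auto)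

lemma petal_path_continuous: "e \<in> arcs G \<Longrightarrow> continuous_map euclideanreal X (petal_path e)"
proof (rule continuous_map_real_lipschitz[where L = 1])
  show "path_dist G l (petal_path e s) (petal_path e t) \<le> 1 * \<bar>s - t\<bar>" if "e \<in> arcs G" for s t
    using petal_path_lipschitz[OF that, of s t] petal_path_lipschitz[OF that, of t s]
    by (cases "s \<le> t") (auto simp: M.commute)
qed auto

lemma \<sigma>_continuous: "v \<in> verts G \<Longrightarrow> continuous_map euclideanreal X (\<sigma> v)"
proof (rule continuous_map_real_lipschitz[where L = 1])
  show "path_dist G l (\<sigma> v s) (\<sigma> v t) \<le> 1 * \<bar>s - t\<bar>" if "v \<in> verts G" for s t
    using \<sigma>_lipschitz[OF that, of s t] \<sigma>_lipschitz[OF that, of t s]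
    by (cases "s \<le> t") (auto simp: M.commute)
qed auto

lemma petal_path_tail: "e \<in> arcs G \<Longrightarrow> t \<le> 0 \<Longrightarrow> petal_path e t = \<sigma> (tail G e) (- t)"
  using len_pos[of e] by (simp add: petal_path_def)

lemma petal_path_head: "e \<in> arcs G \<Longrightarrow> l e \<le> t \<Longrightarrow> petal_path e t = \<sigma> (head G e) (t - l e)"
  using len_pos[of e] \<sigma>_start[of "head G e" 0] edge_pt_ends[of e]
  by (auto simp: petal_path_def)

end

subsection \<open>Collapsing a spanning tree\<close>

text \<open>Here \<open>k\<close> is just the number of edges outside the tree; that it is the rank
  is a matter of homotopy invariance, settled later.\<close>

locale marked_tree = rooted_tree G l r par dep
  for G :: "('v, 'e) pre_digraph" and l and r :: 'v and par :: "'v \<Rightarrow> 'e \<times> bool" and dep +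
  fixes k :: nat and \<beta> :: "'e \<Rightarrow> nat"
  assumes \<beta>: "bij_betw \<beta> (arcs G - T) {..<k}"
begin

fun collapse :: "('v, 'e) gpoint \<Rightarrow> (nat, nat) gpoint" where
  "collapse (Vertex v) = Vertex 0"
| "collapse (Interior e t) = (if e \<in> T then Vertex 0 else Interior (\<beta> e) (t / l e))"

abbreviation "\<gamma> \<equiv> inv_into (arcs G - T) \<beta>"

lemma \<gamma>:
  assumes "i < k"
  shows "\<gamma> i \<in> arcs G - T" "\<beta> (\<gamma> i) = i"
proof -
  have "i \<in> \<beta> ` (arcs G - T)" using \<beta> assms by (simp add: bij_betw_def)
  then show "\<gamma> i \<in> arcs G - T" "\<beta> (\<gamma> i) = i"
    by (rule inv_into_into, rule f_inv_into_f)
qed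

lemma \<gamma>\<beta>: "e \<in> arcs G - T \<Longrightarrow> \<gamma> (\<beta> e) = e" "e \<in> arcs G - T \<Longrightarrow> \<beta> e < k"
  using \<beta> by (auto simp: bij_betw_def)

text \<open>Petal \<open>i\<close> runs through \<open>petal_path\<close> at constant speed; the
  subtraction moves its start to the root.\<close>

fun expand :: "(nat, nat) gpoint \<Rightarrow> ('v, 'e) gpoint" where
  "expand (Vertex v) = Vertex r"
| "expand (Interior i t) = petal_path (\<gamma> i) (t * petal_len (\<gamma> i) - D (tail G (\<gamma> i)))"

lemma collapse_edge_pt_T: "e \<in> T \<Longrightarrow> collapse (edge_pt G l e t) = Vertex 0"
  by (auto simp: edge_pt_def)

lemma collapse_edge_pt:
  "e \<in> arcs G - T \<Longrightarrow> collapse (edge_pt G l e t) = edge_pt (rose k) (\<lambda>_. 1) (\<beta> e) (t / l e)"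
  using len_pos[of e] by (auto simp: edge_pt_def field_simps)

lemma collapse_\<sigma>: "v \<in> verts G \<Longrightarrow> collapse (\<sigma> v t) = Vertex 0"
proof (induction v arbitrary: t rule: tree_induct)
  case (step v)
  then have "pe v \<in> T" by simp
  from collapse_edge_pt_T[OF this] show ?case
    using step \<sigma>_step(1)[OF step(1,2)] by (simp add: ori_pt_def)
qed simp

lemma collapse_petal_path:
  assumes "e \<in> arcs G - T"
  shows "collapse (petal_path e t) = edge_pt (rose k) (\<lambda>_. 1) (\<beta> e) (t / l e)"
  using assms collapse_edge_pt[OF assms] len_pos[of e]
  by (auto simp: petal_path_def collapse_\<sigma> edge_pt_def field_simps)

lemma expand_edge_pt:
  assumes "i < k" "0 \<le> t" "t \<le> 1"
  shows "expand (edge_pt (rose k) (\<lambda>_. 1) i t)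
    = petal_path (\<gamma> i) (t * petal_len (\<gamma> i) - D (tail G (\<gamma> i)))"
proof -
  let ?e = "\<gamma> i"
  have e: "?e \<in> arcs G" "tail G ?e \<in> verts G" "head G ?e \<in> verts G" using \<gamma>[OF assms(1)] by auto
  note D = D_nonneg[OF e(2)] D_nonneg[OF e(3)]
  have "petal_path ?e (- D (tail G ?e)) = Vertex r"
    using petal_path_tail[OF e(1)] D e \<sigma>_end[OF e(2)] by simp
  moreover have "petal_path ?e (petal_len ?e - D (tail G ?e)) = Vertex r"
    using petal_path_head[OF e(1)] D e \<sigma>_end[OF e(3)] by (simp add: petal_len_def)
  ultimately show ?thesis using assms by (auto simp: edge_pt_def)
qed

lemma collapse_lipschitz:
  assumes "0 < c" and "\<And>e. e \<in> arcs G - T \<Longrightarrow> c \<le> l e"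
  shows "lipschitz_map (1 / c) (points G l) (path_dist G l)
    (points (rose k) (\<lambda>_. 1)) (path_dist (rose k) (\<lambda>_. 1)) collapse"
proof (rule lipschitz_map_by_edges[OF R.M.Metric_space_axioms])
  show "collapse \<in> points G l \<rightarrow> points (rose k) (\<lambda>_. 1)"
  proof
    fix x assume "x \<in> points G l"
    then show "collapse x \<in> points (rose k) (\<lambda>_. 1)"
    proof (cases rule: edge_pt_surj)
      case (2 e t)
      then show ?thesis using \<gamma>\<beta>(2)[of e] by auto
    qed simp
  qed
  fix e s t assume A: "e \<in> arcs G" "0 \<le> s" "s \<le> t" "t \<le> l e"
  show "path_dist (rose k) (\<lambda>_. 1) (collapse (edge_pt G l e s)) (collapse (edge_pt G l e t)) \<le> 1 / c * (t - s)"
  proof (cases "e \<in> T")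
    case True
    then show ?thesis using collapse_edge_pt_T[OF True] A \<open>0 < c\<close> by simp
  next
    case False
    then have e: "e \<in> arcs G - T" using A by simp
    have "path_dist (rose k) (\<lambda>_. 1) (collapse (edge_pt G l e s)) (collapse (edge_pt G l e t))
      \<le> \<bar>s / l e - t / l e\<bar>"
      unfolding collapse_edge_pt[OF e] using \<gamma>\<beta>(2)[OF e] by (intro R.edge_pt_lipschitz) simp
    also have "\<dots> = (t - s) / l e" using A len_pos[of e] by (simp add: abs_if field_simps)
    also have "\<dots> \<le> (t - s) / c" using assms(1) assms(2)[OF e] A by (intro divide_left_mono) auto
    finally show ?thesis by simp
  qed
qed (use assms in auto)

lemma collapse_continuous: "continuous_map X (unit_rose k) collapse"
proof -
  \<comment> \<open>Continuity needs only some positive lower bound; the 1 covers a graph without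
    edges.\<close>
  define c where "c = Min (insert 1 (l ` arcs G))"
  have "0 < c" "\<And>e. e \<in> arcs G - T \<Longrightarrow> c \<le> l e" using len_pos by (auto simp: c_def)
  from lipschitz_map_continuous[OF M.Metric_space_axioms R.M.Metric_space_axioms collapse_lipschitz[OF this]]
  show ?thesis .
qed

lemma expand_lipschitz:
  assumes "\<And>e. e \<in> arcs G \<Longrightarrow> petal_len e \<le> c" "0 \<le> c"
  shows "lipschitz_map c (points (rose k) (\<lambda>_. 1)) (path_dist (rose k) (\<lambda>_. 1))
    (points G l) (path_dist G l) expand"
proof (rule R.lipschitz_map_by_edges[OF M.Metric_space_axioms])
  have "petal_path (\<gamma> i) t \<in> points G l" if "i < k" for i t
    using \<gamma>[OF that] by simp
  then show "expand \<in> points (rose k) (\<lambda>_. 1) \<rightarrow> points G l"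
    using root by (auto simp: points_def[of "rose k"])
  fix i s t assume A: "i \<in> arcs (rose k)" "0 \<le> s" "s \<le> t" "t \<le> (1::real)"
  let ?e = "\<gamma> i"
  have i: "i < k" using A by simp
  have e: "?e \<in> arcs G" "tail G ?e \<in> verts G" "head G ?e \<in> verts G" using \<gamma>[of i] A by auto
  have pl: "0 \<le> petal_len ?e" using D_nonneg e len_pos by (simp add: petal_len_def less_imp_le)
  have "path_dist G l (expand (edge_pt (rose k) (\<lambda>_. 1) i s)) (expand (edge_pt (rose k) (\<lambda>_. 1) i t))
     \<le> t * petal_len ?e - s * petal_len ?e"
    using petal_path_lipschitz[OF e(1), of "s * petal_len ?e - D (tail G ?e)" "t * petal_len ?e - D (tail G ?e)"]
      expand_edge_pt[OF i] A pl by (simp add: mult_right_mono)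
  also have "\<dots> \<le> c * (t - s)"
    using mult_right_mono[OF assms(1)[OF e(1)], of "t - s"] A by (simp add: algebra_simps)
  finally show "path_dist G l (expand (edge_pt (rose k) (\<lambda>_. 1) i s))
    (expand (edge_pt (rose k) (\<lambda>_. 1) i t)) \<le> c * (t - s)" .
qed (use assms in auto)

text \<open>Two tree paths and one edge, none longer than the volume: the origin of the factor 3 in
  the Lipschitz constant of \<open>expand\<close>.\<close>

lemma petal_len_le: "e \<in> arcs G \<Longrightarrow> petal_len e \<le> 3 * volume G l"
  using D_le_volume[of "tail G e"] D_le_volume[of "head G e"] member_le_sum[of e "arcs G" l] len_pos
  by (simp add: petal_len_def volume_def less_imp_le)

lemma volume_nonneg: "0 \<le> volume G l"
  using len_pos by (simp add: volume_def sum_nonneg less_imp_le)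

lemma expand_continuous: "continuous_map (unit_rose k) X expand"
  using lipschitz_map_continuous[OF R.M.Metric_space_axioms M.Metric_space_axioms
      expand_lipschitz[OF petal_len_le]] volume_nonneg by simp

lemma collapse_expand: "homotopic_with (\<lambda>_. True) (unit_rose k) (unit_rose k) (collapse \<circ> expand) id"
proof (rule rose_reparametrization)
  \<comment> \<open>On each petal the composite is affine in the parameter: the two tree paths are
    clamped at the base point, and the part between them crosses the petal.\<close>
  let ?\<alpha> = "\<lambda>i t. (t * petal_len (\<gamma> i) - D (tail G (\<gamma> i))) / l (\<gamma> i)"
  have E: "\<gamma> i \<in> arcs G - T" "0 < l (\<gamma> i)" "0 \<le> D (tail G (\<gamma> i))" "0 \<le> D (head G (\<gamma> i))" if "i < k" for i
    using \<gamma>[OF that] len_pos D_nonneg by auto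
  show "continuous_on {0..1} (?\<alpha> i)" if "i < k" for i using E[OF that] by (intro continuous_intros) auto
  show "?\<alpha> i 0 \<le> 0" if "i < k" for i using E[OF that] by (simp add: field_simps)
  show "1 \<le> ?\<alpha> i 1" if "i < k" for i using E[OF that] by (simp add: field_simps petal_len_def)
  show "(collapse \<circ> expand) (Interior i t) = edge_pt (rose k) (\<lambda>_. 1) i (?\<alpha> i t)"
    if "i < k" "0 < t" "t < 1" for i t
    using collapse_petal_path[OF E(1)[OF that(1)]] \<gamma>(2)[OF that(1)] by simp
qed simp

section \<open>The homotopy between the identity and \<open>expand \<circ> collapse\<close>\<close>

definition child :: "'e \<Rightarrow> 'v" where
  "child e = the_inv_into (verts G - {r}) pe e"

lemma child:
  assumes "e \<in> T"
  shows "child e \<in> verts G" "child e \<noteq> r" "pe (child e) = e"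
  using the_inv_into_into[OF inj_pe assms] f_the_inv_into_f[OF inj_pe assms]
  by (auto simp: child_def)

text \<open>A tree edge is pulled into the root along the tree; any other edge is stretched over the
  paths from its ends to the root.\<close>

fun pull :: "real \<Rightarrow> ('v, 'e) gpoint \<Rightarrow> ('v, 'e) gpoint" where
  "pull s (Vertex v) = \<sigma> v (s * D v)"
| "pull s (Interior e t) =
    (if e \<in> T then
       let v = child e; d = (if snd (par v) then t else l e - t) in \<sigma> v (d + s * (D v - d))
     else petal_path e (t + s * (t / l e * (D (tail G e) + D (head G e)) - D (tail G e))))"

text \<open>The formula for interior points reproduces the vertex values at both ends of the edge,
  which is what makes \<open>pull\<close> continuous across the vertices.\<close>

lemma pull_edge_pt:
  assumes e: "e \<in> arcs G - T" and "0 \<le> t" "t \<le> l e" "0 \<le> s"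
  shows "pull s (edge_pt G l e t) =
    petal_path e (t + s * (t / l e * (D (tail G e) + D (head G e)) - D (tail G e)))"
proof -
  have "0 < l e" using e len_pos by simp
  moreover have "0 \<le> D (tail G e)" "0 \<le> D (head G e)" using D_nonneg e by auto
  ultimately show ?thesis
    using assms petal_path_tail[of e] petal_path_head[of e] by (auto simp: edge_pt_def)
qed

lemma pull_edge_pt_T:
  assumes v: "v \<in> verts G" "v \<noteq> r" and "0 \<le> t" "t \<le> l (pe v)" "0 \<le> s"
  defines "d \<equiv> if snd (par v) then t else l (pe v) - t"
  shows "pull s (edge_pt G l (pe v) t) = \<sigma> v (d + s * (D v - d))"
proof -
  have T: "pe v \<in> T" using v by simp
  have c: "child (pe v) = v" using child[OF T] v inj_onD[OF inj_pe] by blast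
  have "0 < l (pe v)" using v par_arc len_pos by simp
  have "0 \<le> D (up v)" using v up_in D_nonneg by simp
  \<comment> \<open>At the upper end of the edge, the climb from \<open>up v\<close> is read as a
    later part of the climb from \<open>v\<close>.\<close>
  have "\<sigma> (up v) (s * D (up v)) = \<sigma> v (l (pe v) + s * (D v - l (pe v)))"
    using \<sigma>_shift[OF v, of "s * D (up v)"] \<open>0 \<le> s\<close> \<open>0 \<le> D (up v)\<close> \<sigma>_step(2)[OF v] by simp
  then show ?thesis
    using assms par_cases[OF v] T c \<open>0 < l (pe v)\<close> 
    by (auto simp: edge_pt_def d_def Let_def split: if_splits)
qed

lemma expand_collapse: "homotopic_with (\<lambda>_. True) X X (expand \<circ> collapse) id"
proof -
  let ?F = "\<lambda>(s, x). pull s x"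
  have "continuous_map (prod_topology (top_of_set {0..1}) X) X ?F"
  proof (rule continuous_map_by_edges_homotopy)
    fix v assume v: "v \<in> verts G"
    have "continuous_map (top_of_set {0..1}) euclideanreal (\<lambda>s. s * D v)"
      by (auto intro!: continuous_intros)
    from continuous_map_compose[OF this \<sigma>_continuous[OF v]]
    show "continuous_map (top_of_set {0..1}) X (\<lambda>s. ?F (s, Vertex v))" by (simp add: o_def)
  next
    fix e assume e: "e \<in> arcs G"
    have l: "0 < l e" using e len_pos by simp
    show "continuous_map (top_of_set ({0..1} \<times> {0..1})) X (\<lambda>(s, t). ?F (s, edge_pt G l e (t * l e)))"
    proof (cases "e \<in> T")
      case True
      then obtain v where v: "v \<in> verts G" "v \<noteq> r" "e = pe v" by auto
      define d where "d t = (if snd (par v) then t * l e else l e - t * l e)" for t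
      have "continuous_on A d" for A unfolding d_def by (cases "snd (par v)") (auto intro!: continuous_intros)
      then have "continuous_on ({0..1} \<times> {0..1}) (\<lambda>p. d (snd p) + fst p * (D v - d (snd p)))"
        by (auto intro!: continuous_intros intro: continuous_on_compose2[OF _ continuous_on_snd])
      then have "continuous_map (top_of_set ({0..1} \<times> {0..1})) euclideanreal (\<lambda>p. d (snd p) + fst p * (D v - d (snd p)))"
        by simp
      from continuous_map_compose[OF this \<sigma>_continuous[OF v(1)]]
      show ?thesis
        by (rule continuous_map_eq)
          (use pull_edge_pt_T[OF v(1,2)] v(3) l in \<open>auto simp: o_def d_def mult_left_le_one_le\<close>)
    next
      case False
      then have e': "e \<in> arcs G - T" using e by simp
      have "continuous_on ({0..1} \<times> {0..1}) (\<lambda>p. snd p * l e + fst p * (snd p * (D (tail G e) + D (head G e)) - D (tail G e)))"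
        by (intro continuous_intros)
      then have "continuous_map (top_of_set ({0..1} \<times> {0..1})) euclideanreal
        (\<lambda>p. snd p * l e + fst p * (snd p * (D (tail G e) + D (head G e)) - D (tail G e)))" by simp
      from continuous_map_compose[OF this petal_path_continuous[OF e]]
      show ?thesis
        by (rule continuous_map_eq)
          (use pull_edge_pt[OF e'] l in \<open>auto simp: o_def mult_left_le_one_le\<close>)
    qed
  qed
  moreover have "pull 0 x = id x" if "x \<in> points G l" for x
    using that
  proof (cases rule: edge_pt_surj)
    case (1 v)
    then show ?thesis using \<sigma>_start[of v 0] by simp
  next
    case (2 e t)
    show ?thesis
    proof (cases "e \<in> T")
      case True
      then obtain v where v: "v \<in> verts G" "v \<noteq> r" "e = pe v" by auto
      then show ?thesis using pull_edge_pt_T[OF v(1,2), of t 0] 2 \<sigma>_step(1)[OF v(1,2)]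
        by (auto simp: ori_pt_def)
    next
      case False
      then show ?thesis using 2 by (auto simp: petal_path_def)
    qed
  qed
  moreover have "pull 1 x = (expand \<circ> collapse) x" if "x \<in> points G l" for x
    using that
  proof (cases rule: edge_pt_surj)
    case (1 v)
    then show ?thesis using \<sigma>_end[of v "D v"] by simp
  next
    case (2 e t)
    show ?thesis
    proof (cases "e \<in> T")
      case True
      then show ?thesis using 2 child[OF True] \<sigma>_end[of "child e" "D (child e)"] by (simp add: Let_def)
    next
      case False
      then have "t + (t / l e * (D (tail G e) + D (head G e)) - D (tail G e)) = t / l e * petal_len e - D (tail G e)"
        using len_pos[of e] 2 by (simp add: petal_len_def field_simps)
      note eq = this
      have "pull 1 x = petal_path e (t + (t / l e * (D (tail G e) + D (head G e)) - D (tail G e)))"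
        using False 2 by simp
      also have "\<dots> = (expand \<circ> collapse) x"
        unfolding eq using False 2 \<gamma>\<beta>(1)[of e] by simp
      finally show ?thesis .
    qed
  qed
  ultimately have "homotopic_with (\<lambda>_. True) X X id (expand \<circ> collapse)"
    by (subst homotopic_with) (auto intro!: exI[of _ ?F])
  then show ?thesis by (rule homotopic_with_symD)
qed

lemma collapse_equivalence: "homotopy_equivalence_map X (unit_rose k) collapse"
  and expand_equivalence: "homotopy_equivalence_map (unit_rose k) X expand"
  using collapse_continuous expand_continuous collapse_expand expand_collapse
  unfolding homotopy_equivalence_map_def by blast+

end

context rooted_tree
begin

lemma marking_exists: "\<exists>\<beta>. marked_tree G l r par dep (card (arcs G) - card T) \<beta>"
proof -
  have "finite (arcs G - T)" by simp
  from ex_bij_betw_finite_nat[OF this] obtain \<beta> where "bij_betw \<beta> (arcs G - T) {0..<card (arcs G - T)}" ..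
  then show ?thesis
    using T_arcs card_Diff_subset[of T "arcs G"]
    by (auto simp: marked_tree_def marked_tree_axioms_def atLeast0LessThan rooted_tree_axioms)
qed

end

subsection \<open>Maps to the punctured plane\<close>

abbreviation punctured_plane :: "complex topology" where
  "punctured_plane \<equiv> top_of_set (- {0})"

lemma continuous_map_complex_mult:
  fixes f g :: "'a \<Rightarrow> complex"
  shows "\<lbrakk>continuous_map X euclidean f; continuous_map X euclidean g\<rbrakk>
    \<Longrightarrow> continuous_map X euclidean (\<lambda>x. f x * g x)"
  by (simp add: continuous_map_atin tendsto_mult)

lemma continuous_map_complex_prod:
  fixes f :: "'a \<Rightarrow> 'b \<Rightarrow> complex"
  shows "\<lbrakk>finite I; \<And>i. i \<in> I \<Longrightarrow> continuous_map X euclidean (f i)\<rbrakk>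
    \<Longrightarrow> continuous_map X euclidean (\<lambda>x. \<Prod>i\<in>I. f i x)"
  by (simp add: continuous_map_atin tendsto_prod)

lemma continuous_map_punctured_plane:
  "continuous_map X punctured_plane f \<longleftrightarrow> continuous_map X euclidean f \<and> (\<forall>x\<in>topspace X. f x \<noteq> 0)"
  by (auto simp: continuous_map_in_subtopology)

text \<open>A homotopy of maps restricts along \<open>c\<close> to a homotopy of loops. Winding
  numbers thus serve as the pairing of a cohomology class of degree 1 with a cycle.\<close>

lemma homotopic_with_winding_number:
  assumes h: "homotopic_with (\<lambda>_. True) Y punctured_plane h h'"
    and c: "continuous_map (top_of_set {0..1}) Y c" "c 0 = c 1"
  shows "winding_number (h \<circ> c) 0 = winding_number (h' \<circ> c) 0"
proof (rule winding_number_homotopic_loops)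
  from h obtain F where F: "continuous_map (prod_topology (top_of_set {0..1::real}) Y) punctured_plane F"
    "\<And>x. F (0, x) = h x" "\<And>x. F (1, x) = h' x"
    unfolding homotopic_with_def by blast
  have "continuous_map (top_of_set ({0..1::real} \<times> {0..1::real})) (top_of_set {0..1::real}) fst"
    "continuous_map (top_of_set ({0..1::real} \<times> {0..1::real})) (top_of_set {0..1::real}) snd"
    by (auto intro!: continuous_intros)
  from this(1) continuous_map_compose[OF this(2) c(1)]
  have "continuous_map (top_of_set ({0..1::real} \<times> {0..1::real})) (prod_topology (top_of_set {0..1::real}) Y)
    (\<lambda>p. (fst p, c (snd p)))"
    unfolding continuous_map_paired by (simp add: o_def)
  from continuous_map_compose[OF this F(1)]
  show "homotopic_loops (- {0}) (h \<circ> c) (h' \<circ> c)"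
    unfolding homotopic_loops using F(2,3) c(2)
    by (intro exI[of _ "F \<circ> (\<lambda>p. (fst p, c (snd p)))"])
      (auto simp: continuous_map_in_subtopology pathfinish_def pathstart_def)
qed

text \<open>Any continuous logarithm computes the winding number: two of them differ at each time by
  an integral multiple of \<open>2 * pi * \<i>\<close>, and a continuous difference with discrete
  range is constant.\<close>

lemma winding_number_exp:
  assumes \<gamma>: "path \<gamma>" and q: "path q" and exp: "\<And>t. t \<in> {0..1} \<Longrightarrow> \<gamma> t = exp (q t)"
  shows "2 * of_real pi * \<i> * winding_number \<gamma> 0 = q 1 - q 0"
proof -
  have "0 \<notin> path_image \<gamma>" using exp by (auto simp: path_image_def)
  from winding_number_as_continuous_log[OF \<gamma> this]
  obtain p where p: "path p" "p 1 - p 0 = 2 * of_real pi * \<i> * winding_number \<gamma> 0"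
    "\<And>t. t \<in> {0..1} \<Longrightarrow> \<gamma> t = exp (p t)"
    by (auto simp: pathfinish_def pathstart_def)
  have "(\<lambda>t. p t - q t) constant_on {0..1}"
  proof (rule continuous_discrete_range_constant)
    show "continuous_on {0..1} (\<lambda>t. p t - q t)"
      using p(1) q by (auto simp: path_def intro!: continuous_intros)
    fix x :: real assume x: "x \<in> {0..1}"
    have int: "\<exists>n::int. p t - q t = 2 * of_int n * of_real pi * \<i>" if "t \<in> {0..1}" for t
    proof -
      have "exp (p t) = exp (q t)" using p(3)[OF that] exp[OF that] by simp
      then show ?thesis by (auto simp: exp_eq algebra_simps)
    qed
    show "\<exists>e>0. \<forall>y. y \<in> {0..1} \<and> p y - q y \<noteq> p x - q x \<longrightarrow> e \<le> norm ((p y - q y) - (p x - q x))"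
    proof (intro exI[of _ "2 * pi"] conjI allI impI)
      fix y assume y: "y \<in> {0..1} \<and> p y - q y \<noteq> p x - q x"
      obtain n n' :: int where n: "p y - q y = 2 * of_int n * of_real pi * \<i>" "p x - q x = 2 * of_int n' * of_real pi * \<i>"
        using int x y by blast
      then have "n \<noteq> n'" using y by auto
      have "(p y - q y) - (p x - q x) = of_real (2 * pi * of_int (n - n')) * \<i>"
        unfolding n by (simp add: algebra_simps)
      then have "norm ((p y - q y) - (p x - q x)) = 2 * pi * \<bar>of_int (n - n')\<bar>"
        by (simp add: norm_mult abs_mult del: of_real_mult of_int_diff)
      moreover have "1 \<le> \<bar>real_of_int (n - n')\<bar>" using \<open>n \<noteq> n'\<close> by linarith
      ultimately show "2 * pi \<le> norm ((p y - q y) - (p x - q x))" by simp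
    qed simp
  qed simp
  then have "p 1 - q 1 = p 0 - q 0" by (force simp: constant_on_def)
  then show ?thesis using p(2) by (simp add: algebra_simps)
qed

text \<open>The sum of logarithms of the factors is a logarithm of the product.\<close>

lemma winding_number_mult_loops:
  assumes g: "path g" "0 \<notin> path_image g" and h: "path h" "0 \<notin> path_image h"
    and k: "path k" "\<And>t. t \<in> {0..1} \<Longrightarrow> k t = g t * h t"
  shows "winding_number k 0 = winding_number g 0 + winding_number h 0"
proof -
  obtain p where p: "path p" "p 1 - p 0 = 2 * of_real pi * \<i> * winding_number g 0"
    "\<And>t. t \<in> {0..1} \<Longrightarrow> g t = exp (p t)"
    using winding_number_as_continuous_log[OF g] by (auto simp: pathfinish_def pathstart_def)
  obtain q where q: "path q" "q 1 - q 0 = 2 * of_real pi * \<i> * winding_number h 0"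
    "\<And>t. t \<in> {0..1} \<Longrightarrow> h t = exp (q t)"
    using winding_number_as_continuous_log[OF h] by (auto simp: pathfinish_def pathstart_def)
  have "path (\<lambda>t. p t + q t)" using p(1) q(1) by (auto simp: path_def intro!: continuous_intros)
  then have "2 * of_real pi * \<i> * winding_number k 0 = (p 1 + q 1) - (p 0 + q 0)"
    using winding_number_exp[OF k(1)] k(2) p(3) q(3) by (simp add: exp_add)
  also have "\<dots> = 2 * of_real pi * \<i> * (winding_number g 0 + winding_number h 0)"
    using p(2) q(2) by (simp add: algebra_simps)
  finally show ?thesis by simp
qed

lemma punctured_plane_path:
  assumes "continuous_map Y punctured_plane h" "continuous_map (top_of_set {0..1}) Y c"
  shows "path (h \<circ> c)" "0 \<notin> path_image (h \<circ> c)"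
  using continuous_map_compose[OF assms(2,1)]
  by (auto simp: path_def path_image_def continuous_map_in_subtopology)

text \<open>This represents the cohomology class dual to \<open>e\<close>: for a loop
  \<open>e\<close>, the winding number is 1 along \<open>e\<close> and 0 along every other loop
  edge.\<close>

definition wrap :: "('e \<Rightarrow> real) \<Rightarrow> 'e \<Rightarrow> ('v, 'e) gpoint \<Rightarrow> complex" where
  "wrap l e x = (case x of Vertex _ \<Rightarrow> 1 | Interior f t \<Rightarrow> if f = e then cis (2 * pi * (t / l e)) else 1)"

context mgraph
begin

lemma wrap_edge_pt:
  assumes "e \<in> arcs G" "0 \<le> t" "t \<le> l f" "f \<in> arcs G"
  shows "wrap l e (edge_pt G l f t) = (if f = e then cis (2 * pi * (t / l e)) else 1)"
  using assms len_pos[OF assms(1)] len_pos[OF assms(4)] by (auto simp: wrap_def edge_pt_def)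

lemma norm_wrap [simp]: "norm (wrap l e x) = 1"
  by (simp add: wrap_def split: gpoint.split)

lemma wrap_neq_0 [simp]: "wrap l e x \<noteq> 0"
  using norm_wrap[of e x] by fastforce

lemma continuous_map_wrap:
  assumes e: "e \<in> arcs G" shows "continuous_map X punctured_plane (wrap l e)"
proof (rule continuous_map_by_edges)
  fix f assume f: "f \<in> arcs G"
  have l: "0 < l f" using len_pos[OF f] .
  have "continuous_map (top_of_set {0..1}) punctured_plane (\<lambda>t. if f = e then cis (2 * pi * t) else 1)"
    by (auto simp: continuous_map_in_subtopology intro!: continuous_intros)
  then show "continuous_map (top_of_set {0..1}) punctured_plane (\<lambda>t. wrap l e (edge_pt G l f (t * l f)))"
    by (rule continuous_map_eq) (use wrap_edge_pt[OF e _ _ f] l in \<open>auto simp: mult_left_le_one_le\<close>)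
qed simp

definition loop_at :: "'e \<Rightarrow> real \<Rightarrow> ('v, 'e) gpoint" where
  "loop_at e t = edge_pt G l e (t * l e)"

lemma loop_at:
  assumes "e \<in> arcs G" "tail G e = head G e"
  shows "continuous_map (top_of_set {0..1}) X (loop_at e)" "loop_at e 0 = loop_at e 1"
proof -
  have "continuous_map (top_of_set {0..1}) euclideanreal (\<lambda>t. t * l e)" by (auto intro!: continuous_intros)
  from continuous_map_compose[OF this continuous_map_edge_pt[OF assms(1)]]
  show "continuous_map (top_of_set {0..1}) X (loop_at e)" by (simp add: loop_at_def[abs_def] o_def)
  show "loop_at e 0 = loop_at e 1" using edge_pt_ends[OF assms(1)] assms(2) by (simp add: loop_at_def)
qed

lemma wrap_loop_at:
  assumes "e \<in> arcs G" "f \<in> arcs G" "t \<in> {0..1}"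
  shows "wrap l e (loop_at f t) = (if f = e then cis (2 * pi * t) else 1)"
  using wrap_edge_pt[OF assms(1) _ _ assms(2), of "t * l f"] assms(3) len_pos[OF assms(2)]
  by (auto simp: loop_at_def mult_left_le_one_le)

lemma winding_number_wrap_loop:
  assumes e: "e \<in> arcs G" "tail G e = head G e"
  shows "winding_number (wrap l e \<circ> loop_at e) 0 = 1"
proof -
  have "2 * of_real pi * \<i> * winding_number (wrap l e \<circ> loop_at e) 0
      = 2 * of_real pi * \<i> * complex_of_real 1 - 2 * of_real pi * \<i> * complex_of_real 0"
  proof (rule winding_number_exp)
    show "path (wrap l e \<circ> loop_at e)"
      by (rule punctured_plane_path(1)[OF continuous_map_wrap[OF e(1)] loop_at(1)[OF e]])
    show "path (\<lambda>t. 2 * of_real pi * \<i> * complex_of_real t)" by (auto simp: path_def intro!: continuous_intros)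
    show "(wrap l e \<circ> loop_at e) t = exp (2 * of_real pi * \<i> * complex_of_real t)" if "t \<in> {0..1}" for t
      using wrap_loop_at[OF e(1) e(1) that] by (simp add: cis_conv_exp algebra_simps)
  qed
  then show ?thesis by simp
qed

text \<open>If \<open>f\<close> missed a point of the loop \<open>e\<close>, then \<open>wrap l e \<circ> f\<close> would miss a point of the unit
  circle and be null-homotopic.\<close>

lemma homotopy_equivalence_hits_loop:
  assumes f: "homotopy_equivalence_map Y X f"
    and e: "e \<in> arcs G" "tail G e = head G e" and t: "0 < t" "t < l e"
  shows "Interior e t \<in> f ` topspace Y"
proof (rule ccontr)
  assume miss: "Interior e t \<notin> f ` topspace Y"
  obtain g where g: "continuous_map Y X f" "continuous_map X Y g"
    "homotopic_with (\<lambda>_. True) X X (f \<circ> g) id"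
    using f unfolding homotopy_equivalence_map_def by blast
  define \<omega> where "\<omega> = cis (2 * pi * (t / l e))"
  define \<Gamma> where "\<Gamma> = (wrap l e \<circ> (f \<circ> g)) \<circ> loop_at e"
  have l: "0 < l e" using t by simp
  \<comment> \<open>The open edge covers the circle without 1 injectively and all other points go to
    1, so \<open>Interior e t\<close> is the only preimage of \<open>\<omega>\<close>.\<close>
  have \<omega>: "wrap l e x \<noteq> \<omega>" if x: "x \<in> points G l" "x \<noteq> Interior e t" for x
  proof
    assume eq: "wrap l e x = \<omega>"
    \<comment> \<open>\<open>s\<close> is the position on the circle as a fraction of a turn; points
      off the open edge sit at 0, which differs from \<open>t / l e\<close>.\<close>
    obtain s where s: "0 \<le> s" "s < 1" "wrap l e x = cis (2 * pi * s)" "s = t / l e \<Longrightarrow> x = Interior e t"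
    proof (cases "\<exists>u. x = Interior e u")
      case True
      then obtain u where u: "x = Interior e u" by blast
      then show ?thesis using that[of "u / l e"] x(1) l by (auto simp: wrap_def)
    next
      case False
      then show ?thesis using that[of 0] t by (cases x) (auto simp: wrap_def)
    qed
    obtain n :: int where "2 * pi * s = 2 * pi * (t / l e) + 2 * pi * n"
    proof -
      have "exp (\<i> * of_real (2 * pi * s)) = exp (\<i> * of_real (2 * pi * (t / l e)))"
        using eq s(3) by (simp only: \<omega>_def cis_conv_exp)
      then obtain n :: int where
        "\<i> * of_real (2 * pi * s) = \<i> * of_real (2 * pi * (t / l e)) + of_real (of_int (2 * n) * pi) * \<i>"
        unfolding exp_eq by blast
      also have "\<dots> = \<i> * of_real (2 * pi * (t / l e) + 2 * pi * n)"
        by (simp add: algebra_simps)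
      finally have "complex_of_real (2 * pi * s) = of_real (2 * pi * (t / l e) + 2 * pi * n)"
        by (subst (asm) mult_cancel_left) simp
      then show ?thesis using that by (simp only: of_real_eq_iff)
    qed
    then have "2 * pi * s = 2 * pi * (t / l e + n)" by (simp only: distrib_left)
    then have "s = t / l e + n" by (subst (asm) mult_cancel_left) simp
    moreover have "0 < t / l e" "t / l e < 1" using t by auto
    ultimately have "n = 0" using s(1,2) by linarith
    then show False using \<open>s = t / l e + n\<close> s(4) x(2) by simp
  qed
  have W: "homotopic_with (\<lambda>_. True) X punctured_plane (wrap l e \<circ> (f \<circ> g)) (wrap l e \<circ> id)"
    by (rule homotopic_with_compose_continuous_map_left[OF g(3) continuous_map_wrap[OF e(1)]]) simp
  from homotopic_with_winding_number[OF W loop_at[OF e]]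
  have "winding_number \<Gamma> 0 = 1" unfolding \<Gamma>_def using winding_number_wrap_loop[OF e] by simp
  \<comment> \<open>A segment between points of the unit circle meets 0 only if they are antipodal,
    and \<open>\<Gamma>\<close> avoids the antipode \<open>\<omega>\<close> of
    \<open>- \<omega>\<close>.\<close>
  moreover have "homotopic_loops (- {0}) \<Gamma> (\<lambda>_. - \<omega>)"
  proof (rule homotopic_loops_linear)
    show "path \<Gamma>"
      unfolding \<Gamma>_def using homotopic_with_imp_continuous_maps[OF W]
      by (intro punctured_plane_path(1)[OF _ loop_at(1)[OF e]]) simp
    show "pathfinish \<Gamma> = pathstart \<Gamma>" using loop_at(2)[OF e] by (simp add: \<Gamma>_def pathfinish_def pathstart_def)
    fix u :: real assume u: "u \<in> {0..1}"
    have "loop_at e u \<in> topspace X" using loop_at(1)[OF e] u by (auto simp: continuous_map_def)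
    then have "g (loop_at e u) \<in> topspace Y" using g(2) by (auto simp: continuous_map_def)
    then have "f (g (loop_at e u)) \<in> f ` topspace Y" by (rule imageI)
    moreover from this have "f (g (loop_at e u)) \<in> points G l"
      using g(1) by (auto simp: continuous_map_def)
    ultimately have "f (g (loop_at e u)) \<in> points G l" "f (g (loop_at e u)) \<noteq> Interior e t"
      using miss by metis+
    then have neq: "\<Gamma> u \<noteq> \<omega>" and norm: "norm (\<Gamma> u) = 1" using \<omega> by (auto simp: \<Gamma>_def)
    show "closed_segment (\<Gamma> u) (- \<omega>) \<subseteq> - {0}"
    proof
      fix z assume "z \<in> closed_segment (\<Gamma> u) (- \<omega>)"
      then obtain a where a: "0 \<le> a" "a \<le> 1" "z = (1 - a) *\<^sub>R \<Gamma> u - a *\<^sub>R \<omega>"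
        by (auto simp: in_segment)
      have "z \<noteq> 0"
      proof
        assume "z = 0"
        then have eq: "(1 - a) *\<^sub>R \<Gamma> u = a *\<^sub>R \<omega>" using a by simp
        then have "norm ((1 - a) *\<^sub>R \<Gamma> u) = norm (a *\<^sub>R \<omega>)" by simp
        then have half: "1 - a = a" using a norm by (simp add: \<omega>_def)
        then have "a \<noteq> 0" by auto
        then show False using eq neq unfolding half by simp
      qed
      then show "z \<in> - {0}" by simp
    qed
  qed (simp_all add: path_def pathfinish_def pathstart_def)
  then have "winding_number \<Gamma> 0 = winding_number (\<lambda>_. - \<omega>) 0" by (rule winding_number_homotopic_loops)
  moreover have "winding_number (\<lambda>_. - \<omega>) 0 = 0" by (rule winding_number_zero_const) (simp add: \<omega>_def)
  ultimately show False by simp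
qed

end

subsection \<open>Rank is a homotopy invariant\<close>

abbreviation "even_winding \<gamma> \<equiv> \<exists>a::int. winding_number \<gamma> 0 = of_int (2 * a)"

text \<open>Applied to two factors of equal parity and, with both factors the same, to a
  square.\<close>

lemma even_winding_mult:
  assumes g: "path g" "0 \<notin> path_image g" "g 0 = g 1" and h: "path h" "0 \<notin> path_image h" "h 0 = h 1"
    and k: "path k" "\<And>t. t \<in> {0..1} \<Longrightarrow> k t = g t * h t"
    and par: "even_winding g \<longleftrightarrow> even_winding h"
  shows "even_winding k"
proof -
  have "winding_number g 0 \<in> \<int>" "winding_number h 0 \<in> \<int>"
    using integer_winding_number_eq[OF g(1,2)] integer_winding_number_eq[OF h(1,2)] g(3) h(3)
    by (simp_all add: pathfinish_def pathstart_def)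
  then obtain a b :: int where ab: "winding_number g 0 = of_int a" "winding_number h 0 = of_int b"
    by (auto elim!: Ints_cases)
  have "even a \<longleftrightarrow> even b"
    using par unfolding ab of_int_eq_iff by (simp add: dvd_def)
  then have "even (a + b)" by simp
  then obtain c where "a + b = 2 * c" by (elim evenE)
  then show ?thesis
    using winding_number_mult_loops[OF g(1,2) h(1,2) k] ab by (metis of_int_add)
qed

text \<open>A logarithm along a petal changes by an even multiple of \<open>2 * pi * \<i>\<close>,
  so half of it changes by a multiple of \<open>2 * pi * \<i>\<close> and its exponential closes
  up.\<close>

lemma rose_square_root:
  assumes h: "continuous_map (unit_rose n) punctured_plane h"
    and even: "\<And>j. j < n \<Longrightarrow> even_winding (h \<circ> R.loop_at n j)"
  shows "\<exists>k. continuous_map (unit_rose n) punctured_plane k \<and> (\<forall>x\<in>points (rose n) (\<lambda>_. 1). h x = k x * k x)"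
proof -
  have "\<exists>q a. path q \<and> q 1 - q 0 = 2 * of_real pi * \<i> * of_int (2 * a) \<and>
      (\<forall>t\<in>{0..1}. (h \<circ> R.loop_at n j) t = exp (q t))" if j: "j < n" for j
  proof -
    note p = punctured_plane_path[OF h R.loop_at(1)[of j n]]
    obtain a :: int where "winding_number (h \<circ> R.loop_at n j) 0 = of_int (2 * a)" using even[OF j] by blast
    moreover obtain q where "path q" "pathfinish q - pathstart q = 2 * of_real pi * \<i> * winding_number (h \<circ> R.loop_at n j) 0"
       "\<And>t. t \<in> {0..1} \<Longrightarrow> (h \<circ> R.loop_at n j) t = 0 + exp (q t)"
      using winding_number_as_continuous_log[of "h \<circ> R.loop_at n j" 0] p j by auto
    ultimately show ?thesis by (intro exI[of _ q] exI[of _ a]) (simp add: pathfinish_def pathstart_def)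
  qed
  then have "\<forall>j. \<exists>q. j < n \<longrightarrow> path q \<and> (\<exists>a::int. q 1 - q 0 = 2 * of_real pi * \<i> * of_int (2 * a)) \<and>
      (\<forall>t\<in>{0..1}. (h \<circ> R.loop_at n j) t = exp (q t))"
    by blast
  then obtain q where "\<forall>j. j < n \<longrightarrow> path (q j) \<and> (\<exists>a::int. q j 1 - q j 0 = 2 * of_real pi * \<i> * of_int (2 * a)) \<and>
      (\<forall>t\<in>{0..1}. (h \<circ> R.loop_at n j) t = exp (q j t))"
    unfolding choice_iff by blast
  then have q: "\<And>j. j < n \<Longrightarrow> path (q j)"
    "\<And>j. j < n \<Longrightarrow> \<exists>a::int. q j 1 - q j 0 = 2 * of_real pi * \<i> * of_int (2 * a)"
    "\<And>j t. j < n \<Longrightarrow> t \<in> {0..1} \<Longrightarrow> h (R.loop_at n j t) = exp (q j t)"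
    by simp_all
  define z where "z = csqrt (h (Vertex 0))"
  have "h (Vertex 0) \<noteq> 0" using h by (auto simp: continuous_map_punctured_plane)
  then have z: "z * z = h (Vertex 0)" "z \<noteq> 0"
    by (simp_all add: z_def flip: power2_eq_square)
  \<comment> \<open>Logarithms on different petals may disagree at the base point. Subtracting
    \<open>q j 0\<close> and using one square root \<open>z\<close> makes the pieces agree
    there.\<close>
  define k where "k x = (case x of Vertex (_::nat) \<Rightarrow> z | Interior j t \<Rightarrow> z * exp ((q j t - q j 0) / 2))" for x
  have k: "k (edge_pt (rose n) (\<lambda>_. 1) j t) = z * exp ((q j t - q j 0) / 2)" if j: "j < n" and t: "t \<in> {0..1}" for j t
  proof -
    obtain a :: int where "q j 1 - q j 0 = 2 * of_real pi * \<i> * of_int (2 * a)"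
      using q(2)[OF j] by blast
    then have "exp ((q j 1 - q j 0) / 2) = exp ((2 * of_int a * pi) * \<i>)"
      by (simp add: algebra_simps)
    also have "\<dots> = 1" using exp_integer_2pi[of "of_int a"] by simp
    finally show ?thesis using j t by (auto simp: k_def edge_pt_def)
  qed
  have "continuous_map (unit_rose n) punctured_plane k"
  proof (rule R.continuous_map_by_edges)
    fix j assume j: "j \<in> arcs (rose n)"
    have "continuous_map (top_of_set {0..1}) punctured_plane (\<lambda>t. z * exp ((q j t - q j 0) / 2))"
      using q(1)[of j] j z(2)
      by (auto simp: continuous_map_in_subtopology path_def intro!: continuous_intros)
    then show "continuous_map (top_of_set {0..1}) punctured_plane (\<lambda>t. k (edge_pt (rose n) (\<lambda>_. 1) j (t * 1)))"
      by (rule continuous_map_eq) (use k j in auto)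
  qed (simp add: k_def z)
  moreover have "h x = k x * k x" if "x \<in> points (rose n) (\<lambda>_. 1)" for x
    using that
  proof (cases rule: R.edge_pt_surj)
    case (1 v)
    then show ?thesis using z by (simp add: k_def)
  next
    case (2 j t)
    then have j: "j < n" and t: "t \<in> {0..1}" by auto
    have "h (Vertex 0) = exp (q j 0)"
      using q(3)[OF j, of 0] by (simp add: R.loop_at_def edge_pt_def)
    moreover have "h x = exp (q j t)" using q(3)[OF j t] 2 by (simp add: R.loop_at_def)
    moreover have "k x = z * exp ((q j t - q j 0) / 2)" using k[OF j t] 2 by simp
    then have "k x * k x = (z * z) * (exp ((q j t - q j 0) / 2) * exp ((q j t - q j 0) / 2))"
      by (simp only: ac_simps)
    then have "k x * k x = h (Vertex 0) * exp (q j t - q j 0)"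
      unfolding z exp_add[symmetric] by simp
    ultimately show ?thesis by (simp add: exp_diff)
  qed
  ultimately show ?thesis by blast
qed

text \<open>For sets \<open>S\<close> of petals let \<open>h S\<close> be the product of the maps wrapping the petals in \<open>S\<close> around
  the circle. If two of the pullbacks of the \<open>h S\<close> under \<open>g\<close> have equal winding parities, then their
  product is a square, and hence so is the product of the two \<open>h S\<close>, up to homotopy.\<close>

lemma rose_rank_le:
  assumes f: "continuous_map (unit_rose m) (unit_rose n) f"
    and g: "continuous_map (unit_rose n) (unit_rose m) g"
    and gf: "homotopic_with (\<lambda>_. True) (unit_rose m) (unit_rose m) (g \<circ> f) id"
  shows "m \<le> n"
proof (rule ccontr)
  assume "\<not> m \<le> n"
  define h where "h S x = (\<Prod>i\<in>S. wrap (\<lambda>_. 1) i x)" for S and x :: "(nat, nat) gpoint"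
  define P where "P S = {j \<in> {..<n}. even_winding ((h S \<circ> g) \<circ> R.loop_at n j)}" for S
  have h_cont: "continuous_map (unit_rose m) punctured_plane (h S)" if "S \<subseteq> {..<m}" for S
    unfolding h_def continuous_map_punctured_plane
    using that R.continuous_map_wrap[of _ m] finite_subset[OF that]
    by (auto simp: continuous_map_punctured_plane intro!: continuous_map_complex_prod)
  \<comment> \<open>There are \<open>2 ^ m\<close> sets of petals but at most \<open>2 ^ n\<close>
    parity patterns.\<close>
  have "\<not> inj_on P (Pow {..<m})"
  proof
    assume "inj_on P (Pow {..<m})"
    then have "card (Pow {..<m}) \<le> card (Pow {..<n})"
      by (rule card_inj_on_le) (auto simp: P_def)
    then show False using \<open>\<not> m \<le> n\<close> by (simp add: card_Pow)
  qed
  then obtain S S' where S: "S \<subseteq> {..<m}" "S' \<subseteq> {..<m}" "S \<noteq> S'" "P S = P S'"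
    by (auto simp: inj_on_def)
  define H where "H x = h S x * h S' x" for x
  have H_cont: "continuous_map (unit_rose m) punctured_plane H"
    using h_cont[OF S(1)] h_cont[OF S(2)] continuous_map_complex_mult[of "unit_rose m" "h S" "h S'"]
    unfolding continuous_map_punctured_plane H_def[abs_def] by auto
  have Hg: "continuous_map (unit_rose n) punctured_plane (H \<circ> g)"
    using g H_cont by (rule continuous_map_compose)
  have "even_winding ((H \<circ> g) \<circ> R.loop_at n j)" if j: "j < n" for j
  proof -
    have L: "continuous_map (top_of_set {0..1}) (unit_rose n) (R.loop_at n j)" "R.loop_at n j 0 = R.loop_at n j 1"
      using R.loop_at[of j n] j by auto
    have hg: "continuous_map (unit_rose n) punctured_plane (h S \<circ> g)"
      "continuous_map (unit_rose n) punctured_plane (h S' \<circ> g)"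
      using continuous_map_compose[OF g h_cont] S by simp_all
    show ?thesis
    proof (rule even_winding_mult)
      show "even_winding ((h S \<circ> g) \<circ> R.loop_at n j) \<longleftrightarrow> even_winding ((h S' \<circ> g) \<circ> R.loop_at n j)"
        using S(4) j unfolding P_def by blast
    qed (use punctured_plane_path[OF hg(1) L(1)] punctured_plane_path[OF hg(2) L(1)]
        punctured_plane_path[OF Hg L(1)] L(2) in \<open>auto simp: H_def\<close>)
  qed
  from rose_square_root[OF Hg this] obtain k where k: "continuous_map (unit_rose n) punctured_plane k"
    "\<And>x. x \<in> points (rose n) (\<lambda>_. 1) \<Longrightarrow> (H \<circ> g) x = k x * k x" by blast
  \<comment> \<open>A petal in exactly one of the two sets: \<open>H\<close> winds around it
    once.\<close>
  obtain i where i: "i < m" "i \<in> S \<longleftrightarrow> i \<notin> S'" using S by blast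
  have L: "continuous_map (top_of_set {0..1}) (unit_rose m) (R.loop_at m i)" "R.loop_at m i 0 = R.loop_at m i 1"
    using R.loop_at[of i m] i by auto
  have HS: "h A (R.loop_at m i t) = (if i \<in> A then cis (2 * pi * t) else 1)" if "t \<in> {0..1}" "A \<subseteq> {..<m}" for t A
  proof -
    have "h A (R.loop_at m i t) = (\<Prod>j\<in>A. if j = i then cis (2 * pi * t) else 1)"
      unfolding h_def using that R.wrap_loop_at[of _ m i t] i(1) by (intro prod.cong) auto
    also have "\<dots> = (if i \<in> A then cis (2 * pi * t) else 1)"
      using finite_subset[OF that(2)] by (simp add: prod.delta)
    finally show ?thesis .
  qed
  have "(H \<circ> R.loop_at m i) t = cis (2 * pi * t)" if "t \<in> {0..1}" for t
    using HS[OF that S(1)] HS[OF that S(2)] i(2) by (auto simp: H_def)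
  moreover have "wrap (\<lambda>_. 1) i (R.loop_at m i t) = cis (2 * pi * t)" if "t \<in> {0..1}" for t
    using R.wrap_loop_at[of i m i t] i that by simp
  ultimately have eq: "(H \<circ> R.loop_at m i) t = exp (2 * of_real pi * \<i> * complex_of_real t)" if "t \<in> {0..1}" for t
    using that by (simp add: cis_conv_exp algebra_simps)
  have "2 * of_real pi * \<i> * winding_number (H \<circ> R.loop_at m i) 0
     = 2 * of_real pi * \<i> * complex_of_real 1 - 2 * of_real pi * \<i> * complex_of_real 0"
    using punctured_plane_path[OF H_cont L(1)] eq
    by (intro winding_number_exp) (auto simp: path_def intro!: continuous_intros)
  then have one: "winding_number (H \<circ> R.loop_at m i) 0 = 1" by simp
  have hom: "homotopic_with (\<lambda>_. True) (unit_rose m) punctured_plane (H \<circ> (g \<circ> f)) (H \<circ> id)"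
    by (rule homotopic_with_compose_continuous_map_left[OF gf H_cont]) simp
  have two: "winding_number ((H \<circ> (g \<circ> f)) \<circ> R.loop_at m i) 0 = 1"
    using homotopic_with_winding_number[OF hom L] one by simp
  have kf: "continuous_map (unit_rose m) punctured_plane (k \<circ> f)" using f k(1) by (rule continuous_map_compose)
  have kf': "path ((k \<circ> f) \<circ> R.loop_at m i)" "0 \<notin> path_image ((k \<circ> f) \<circ> R.loop_at m i)"
    using punctured_plane_path[OF kf L(1)] .
  have Hgf: "continuous_map (unit_rose m) punctured_plane (H \<circ> (g \<circ> f))"
    using homotopic_with_imp_continuous_maps[OF hom] by blast
  \<comment> \<open>This map is the square of \<open>k \<circ> f\<close> along the petal, yet it is
    homotopic to \<open>H\<close>, whose winding number there is 1.\<close>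
  have "even_winding ((H \<circ> (g \<circ> f)) \<circ> R.loop_at m i)"
  proof (rule even_winding_mult[OF kf' _ kf'])
    show "path ((H \<circ> (g \<circ> f)) \<circ> R.loop_at m i)" using punctured_plane_path[OF Hgf L(1)] by simp
    fix t :: real assume t: "t \<in> {0..1}"
    have "R.loop_at m i t \<in> topspace (unit_rose m)" using L(1) t by (auto simp: continuous_map_def)
    then have "f (R.loop_at m i t) \<in> points (rose n) (\<lambda>_. 1)" using f by (auto simp: continuous_map_def)
    from k(2)[OF this] show "((H \<circ> (g \<circ> f)) \<circ> R.loop_at m i) t
      = ((k \<circ> f) \<circ> R.loop_at m i) t * ((k \<circ> f) \<circ> R.loop_at m i) t" by simp
  qed (use L(2) in auto)
  then obtain a :: int where "winding_number ((H \<circ> (g \<circ> f)) \<circ> R.loop_at m i) 0 = of_int (2 * a)" by blast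
  then have "(of_int (2 * a) :: complex) = of_int 1" using two by simp
  then have "2 * a = 1" by (simp only: of_int_eq_iff)
  then show False by presburger
qed

lemma rose_rank_unique:
  assumes "unit_rose m homotopy_equivalent_space unit_rose n"
  shows "m = n"
proof -
  obtain f g where "continuous_map (unit_rose m) (unit_rose n) f" "continuous_map (unit_rose n) (unit_rose m) g"
    "homotopic_with (\<lambda>_. True) (unit_rose m) (unit_rose m) (g \<circ> f) id"
    "homotopic_with (\<lambda>_. True) (unit_rose n) (unit_rose n) (f \<circ> g) id"
    using assms unfolding homotopy_equivalent_space_def by blast
  then show ?thesis using rose_rank_le[of m n f g] rose_rank_le[of n m g f] by simp
qed

subsection \<open>Minimal spanning trees and the upper bound\<close>

context mgraph
begin

section \<open>Spanning edge sets and the trees inside them\<close>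

definition adj :: "'e set \<Rightarrow> ('v \<times> 'v) set" where
  "adj A = {(tail (oriented G) a, head (oriented G) a) | a. fst a \<in> A}"

lemma adjI: "fst a \<in> A \<Longrightarrow> (tail (oriented G) a, head (oriented G) a) \<in> adj A"
  unfolding adj_def by blast

lemma sym_adj: "sym (adj A)"
proof (rule symI)
  fix u v assume "(u, v) \<in> adj A"
  then obtain e b where "e \<in> A" "u = tail (oriented G) (e, b)" "v = head (oriented G) (e, b)"
    by (auto simp: adj_def)
  then show "(v, u) \<in> adj A" using adjI[of "(e, \<not> b)" A] by (cases b) auto
qed

lemma edge_path_adj: "edge_path G u p v \<Longrightarrow> fst ` set p \<subseteq> A \<Longrightarrow> (u, v) \<in> (adj A)\<^sup>*"
proof (induction p arbitrary: u)
  case (Cons a p)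
  then have "(head (oriented G) a, v) \<in> (adj A)\<^sup>*" "tail (oriented G) a = u"
    by (auto simp: O.awalk_Cons_iff)
  moreover have "(tail (oriented G) a, head (oriented G) a) \<in> adj A" using Cons.prems(2) by (intro adjI) auto
  ultimately show ?case by (metis converse_rtrancl_into_rtrancl)
qed (simp add: O.awalk_Nil_iff)

lemma adj_edge_path:
  assumes "(u, v) \<in> (adj A)\<^sup>*" "A \<subseteq> arcs G" "v \<in> verts G"
  shows "\<exists>p. edge_path G u p v \<and> fst ` set p \<subseteq> A"
  using assms(1)
proof (induction rule: converse_rtrancl_induct)
  case base
  then show ?case using assms by (intro exI[of _ "[]"]) (simp add: O.awalk_Nil_iff)
next
  case (step u w)
  then obtain a p where a: "fst a \<in> A" "u = tail (oriented G) a" "w = head (oriented G) a"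
    and p: "edge_path G w p v" "fst ` set p \<subseteq> A" by (auto simp: adj_def)
  then show ?case using assms(2)
    by (intro exI[of _ "a # p"]) (cases a; auto simp: O.awalk_Cons_iff)
qed

text \<open>Reaching the one vertex \<open>r\<close> amounts to connectedness because
  \<open>adj A\<close> is symmetric. Cycles are permitted.\<close>

definition spans :: "'v \<Rightarrow> 'e set \<Rightarrow> bool" where
  "spans r A \<longleftrightarrow> A \<subseteq> arcs G \<and> (\<forall>v\<in>verts G. (v, r) \<in> (adj A)\<^sup>*)"

lemma spans_arcs: "r \<in> verts G \<Longrightarrow> spans r (arcs G)"
  unfolding spans_def
proof (intro conjI ballI)
  fix v assume "r \<in> verts G" "v \<in> verts G"
  then obtain p where p: "edge_path G v p r" using path_exists[OF mg] by blast
  then have "fst ` set p \<subseteq> arcs G" by (auto simp: O.awalk_def)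
  then show "(v, r) \<in> (adj (arcs G))\<^sup>*" using edge_path_adj p by blast
qed simp

text \<open>Breadth-first search: \<open>dep\<close> is the distance to \<open>r\<close> inside
  \<open>A\<close>, and the parent edge begins a shortest path.\<close>

lemma rooted_tree_exists:
  assumes r: "r \<in> verts G" and A: "spans r A"
  shows "\<exists>par dep. rooted_tree G l r par dep \<and> (fst \<circ> par) ` (verts G - {r}) \<subseteq> A"
proof -
  define dep where "dep v = (LEAST k. (v, r) \<in> adj A ^^ k)" for v
  have dep: "(v, r) \<in> adj A ^^ dep v" if "v \<in> verts G" for v
  proof -
    have "(v, r) \<in> (adj A)\<^sup>*" using A that by (simp add: spans_def)
    then obtain k where "(v, r) \<in> adj A ^^ k" using rtrancl_imp_relpow by blast
    then show ?thesis unfolding dep_def by (rule LeastI)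
  qed
  have "\<exists>a. fst a \<in> A \<and> tail (oriented G) a = v \<and> dep v = Suc (dep (head (oriented G) a))"
    if v: "v \<in> verts G" "v \<noteq> r" for v
  proof -
    have "dep v \<noteq> 0"
    proof
      assume "dep v = 0"
      then show False using dep[OF v(1)] v(2) by simp
    qed
    then obtain k where k: "dep v = Suc k" by (cases "dep v") auto
    then obtain w where w: "(v, w) \<in> adj A" "(w, r) \<in> adj A ^^ k"
      using dep[OF v(1)] by (auto simp del: relpow.simps elim: relpow_Suc_E2)
    have "dep w \<le> k" unfolding dep_def using w(2) by (rule Least_le)
    have "(w, r) \<in> adj A ^^ dep w" unfolding dep_def using w(2) by (rule LeastI)
    then have "(v, r) \<in> adj A ^^ Suc (dep w)" using w(1) by (rule relpow_Suc_I2[rotated])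
    then have "dep v \<le> Suc (dep w)" unfolding dep_def[of v] by (rule Least_le)
    then have "dep v = Suc (dep w)" using \<open>dep w \<le> k\<close> k by simp
    moreover obtain a where "fst a \<in> A" "v = tail (oriented G) a" "w = head (oriented G) a"
      using w(1) unfolding adj_def by blast
    ultimately show ?thesis by (intro exI[of _ a]) simp
  qed
  then have "\<forall>v. \<exists>a. v \<in> verts G \<and> v \<noteq> r \<longrightarrow>
      fst a \<in> A \<and> tail (oriented G) a = v \<and> dep v = Suc (dep (head (oriented G) a))"
    by blast
  then obtain par where "\<forall>v. v \<in> verts G \<and> v \<noteq> r \<longrightarrow>
      fst (par v) \<in> A \<and> tail (oriented G) (par v) = v \<and> dep v = Suc (dep (head (oriented G) (par v)))"
    unfolding choice_iff by blast
  then have par: "\<And>v. \<lbrakk>v \<in> verts G; v \<noteq> r\<rbrakk> \<Longrightarrow> fst (par v) \<in> A"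
    "\<And>v. \<lbrakk>v \<in> verts G; v \<noteq> r\<rbrakk> \<Longrightarrow> tail (oriented G) (par v) = v"
    "\<And>v. \<lbrakk>v \<in> verts G; v \<noteq> r\<rbrakk> \<Longrightarrow> dep v = Suc (dep (head (oriented G) (par v)))"
    by blast+
  have "dep r \<le> 0" unfolding dep_def by (rule Least_le) simp
  then have "rooted_tree G l r par dep"
    using r par A by unfold_locales (auto simp: spans_def)
  then show ?thesis using par(1) by (intro exI[of _ par] exI[of _ dep]) auto
qed

text \<open>A second passage through the first edge, in either direction, would revisit its starting
  vertex \<open>u\<close>.\<close>

lemma apath_distinct_edges:
  "pre_digraph.apath (oriented G) u p v \<Longrightarrow> distinct (map fst p)"
proof (induction p arbitrary: u)
  case (Cons a p)
  let ?w = "head (oriented G) a"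
  have p: "O.apath ?w p v" and u: "tail (oriented G) a = u" "u \<notin> set (O.awalk_verts ?w p)"
    using Cons.prems by (auto simp: O.apath_Cons_iff)
  have "fst a \<notin> fst ` set p"
  proof
    assume "fst a \<in> fst ` set p"
    then obtain a' where a': "a' \<in> set p" "fst a' = fst a" by auto
    have "p \<noteq> []" using a' by auto
    have "O.cas ?w p v" using p by (auto simp: O.apath_def O.awalk_def)
    then have "head (oriented G) a' \<in> set (O.awalk_verts ?w p)"
      using a'(1) by (auto simp: O.awalk_verts_conv'[of ?w p v])
    moreover have "tail (oriented G) a' \<in> set (O.awalk_verts ?w p)"
      using a'(1) by (auto simp: O.awalk_verts_conv[of ?w p])
    moreover have "u = tail (oriented G) a' \<or> u = head (oriented G) a'"
      using a'(2) u(1) by (cases a; cases a') auto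
    ultimately show False using u(2) by auto
  qed
  then show ?case using Cons.IH[OF p] by simp
qed simp

lemma distinct_edges_no_backtracking:
  "distinct (map fst p) \<Longrightarrow> successively (\<lambda>(e, b) (e', b'). \<not> (e' = e \<and> b' \<noteq> b)) p"
  by (induction p rule: induct_list012) auto

lemma path_length_le: "(\<And>e. e \<in> fst ` set p \<Longrightarrow> l e \<le> c) \<Longrightarrow> path_length l p \<le> real (length p) * c"
proof (induction p)
  case (Cons a p)
  then have "l (fst a) \<le> c" "path_length l p \<le> real (length p) * c" by auto
  then show ?case by (simp add: algebra_simps)
qed simp

text \<open>In a spanning tree of minimal total length, every edge outside the tree is the longest edge of
  its fundamental cycle.\<close>

lemma minimal_tree_short_loop:
  assumes tree: "rooted_tree G l r par dep" and T: "T = (fst \<circ> par) ` (verts G - {r})"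
    and min: "\<And>A. spans r A \<Longrightarrow> sum l T \<le> sum l A"
    and f: "f \<in> arcs G - T"
  shows "\<exists>p. is_loop G p \<and> path_length l p \<le> real (card (verts G)) * l f"
proof -
  interpret rooted_tree G l r par dep by fact
  interpret OF: fin_digraph "oriented G" by unfold_locales auto
  have lf: "0 < l f" using f len_pos by simp
  have Tsub: "T \<subseteq> arcs G" using T T_arcs by auto
  have "(v, r) \<in> (adj T)\<^sup>*" if "v \<in> verts G" for v
    using that
  proof (induction rule: tree_induct)
    case (step v)
    have "(tail (oriented G) (par v), up v) \<in> adj T" using step T by (intro adjI) auto
    then show ?case using step par_tail[of v] by (metis converse_rtrancl_into_rtrancl)
  qed simp
  then have conn: "spans r T" using Tsub by (simp add: spans_def)
  let ?x = "tail G f" and ?y = "head G f"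
  have xy: "?x \<in> verts G" "?y \<in> verts G" using f by auto
  have "(r, ?x) \<in> (adj T)\<^sup>*" using conn xy sym_rtrancl[OF sym_adj] by (auto simp: spans_def dest: symD)
  then have "(?y, ?x) \<in> (adj T)\<^sup>*" using conn xy by (auto simp: spans_def)
  then obtain q where q: "edge_path G ?y q ?x" "fst ` set q \<subseteq> T"
    using adj_edge_path Tsub xy by blast
  define p where "p = O.awalk_to_apath q"
  have p: "O.apath ?y p ?x" "set p \<subseteq> set q"
    using O.apath_awalk_to_apath[OF q(1)] O.awalk_to_apath_subset[OF q(1)] by (simp_all add: p_def)
  then have pT: "fst ` set p \<subseteq> T" using q(2) by blast
  have awp: "edge_path G ?y p ?x" using p(1) by (simp add: O.apath_def)
  have dist: "distinct (map fst p)" using apath_distinct_edges p(1) by blast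
  have short: "l e \<le> l f" if e: "e \<in> fst ` set p" for e
  proof (rule ccontr)
    assume "\<not> l e \<le> l f"
    from e obtain a where a: "a \<in> set p" "fst a = e" by auto
    then obtain p1 p2 where p12: "p = p1 @ a # p2" by (auto simp: in_set_conv_decomp)
    have walks: "edge_path G ?y p1 (tail (oriented G) a)" "edge_path G (head (oriented G) a) p2 ?x"
      using awp unfolding p12 by (auto simp: O.awalk_append_iff O.awalk_Cons_iff)
    \<comment> \<open>\<open>A\<close> exchanges \<open>e\<close> for \<open>f\<close>. The rest of
      the cycle, made of \<open>p1\<close>, \<open>f\<close> and \<open>p2\<close>, still joins the
      ends of \<open>e\<close>, so \<open>A\<close> spans and would be shorter.\<close>
    define A where "A = insert f (T - {e})"
    have "e \<notin> fst ` set p1" "e \<notin> fst ` set p2"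
      using dist a(2) unfolding p12 by auto
    moreover have "fst ` set p1 \<subseteq> T" "fst ` set p2 \<subseteq> T"
      using pT unfolding p12 by auto
    ultimately have sub: "fst ` set p1 \<subseteq> A" "fst ` set p2 \<subseteq> A"
      unfolding A_def by blast+
    have S: "sym ((adj A)\<^sup>*)" using sym_rtrancl[OF sym_adj] .
    have "(?x, ?y) \<in> adj A" using adjI[of "(f, True)" A] by (simp add: A_def)
    then have a_conn: "(tail (oriented G) a, head (oriented G) a) \<in> (adj A)\<^sup>*"
      using edge_path_adj[OF walks(1) sub(1)] edge_path_adj[OF walks(2) sub(2)] S
      by (meson r_into_rtrancl rtrancl_trans symD)
    have "adj T \<subseteq> (adj A)\<^sup>*"
    proof
      fix z assume "z \<in> adj T"
      then obtain a' where a': "fst a' \<in> T" "z = (tail (oriented G) a', head (oriented G) a')"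
        by (auto simp: adj_def)
      show "z \<in> (adj A)\<^sup>*"
      proof (cases "fst a' = e")
        case True
        then have "z = (tail (oriented G) a, head (oriented G) a) \<or> z = (head (oriented G) a, tail (oriented G) a)"
          using a'(2) a(2) by (cases a; cases a') auto
        then show ?thesis using a_conn S by (auto dest: symD)
      next
        case False
        then show ?thesis using a' adjI[of a' A] by (auto simp: A_def)
      qed
    qed
    then have "(adj T)\<^sup>* \<subseteq> (adj A)\<^sup>*" by (metis rtrancl_mono rtrancl_idemp)
    then have "spans r A" using conn f by (auto simp: spans_def A_def)
    from min[OF this] have "sum l T \<le> sum l A" .
    also have "sum l A = l f + sum l T - l e"
      using f pT e finite_subset[OF Tsub] unfolding A_def by (auto simp: sum_diff1)
    finally show False using \<open>\<not> l e \<le> l f\<close> by simp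
  qed
  have "is_loop G ((f, True) # p)"
    unfolding is_loop_def
  proof (intro conjI exI[of _ ?x])
    show "edge_path G ?x ((f, True) # p) ?x" using awp f by (simp add: O.awalk_Cons_iff)
    show "successively (\<lambda>(e, b) (e', b'). \<not> (e' = e \<and> b' \<noteq> b)) ((f, True) # p)"
      by (rule distinct_edges_no_backtracking) (use dist pT f in auto)
  qed simp
  moreover have "path_length l ((f, True) # p) \<le> real (card (verts G)) * l f"
  proof -
    \<comment> \<open>The simple path \<open>p\<close> has fewer edges than there are vertices, so
      \<open>f\<close> together with \<open>p\<close> has at most \<open>card (verts G)\<close>
      edges.\<close>
    have "path_length l ((f, True) # p) \<le> real (length ((f, True) # p)) * l f"
      by (rule path_length_le) (use short in auto)
    also have "\<dots> \<le> real (card (verts G)) * l f"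
      using OF.length_apath_less[OF p(1)] lf by (intro mult_right_mono) auto
    finally show ?thesis .
  qed
  ultimately show ?thesis by blast
qed

text \<open>The minimum is taken over the finite nonempty family of all spanning edge sets. A rooted
  tree inside a minimizer is no longer than it, hence no longer than any spanning set.\<close>

lemma good_tree_exists:
  obtains r par dep where "rooted_tree G l r par dep"
    "\<And>f. f \<in> arcs G - (fst \<circ> par) ` (verts G - {r}) \<Longrightarrow>
       \<exists>p. is_loop G p \<and> path_length l p \<le> real (card (verts G)) * l f"
proof -
  obtain r where r: "r \<in> verts G"
    using mg by (auto simp: metric_graph_def strongly_connected_def)
  define \<A> where "\<A> = {A. spans r A}"
  have fin: "finite \<A>" by (rule finite_subset[of _ "Pow (arcs G)"]) (auto simp: \<A>_def spans_def)
  moreover have "\<A> \<noteq> {}" using spans_arcs[OF r] by (auto simp: \<A>_def)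
  ultimately obtain A where A: "A \<in> \<A>" "\<And>B. B \<in> \<A> \<Longrightarrow> sum l A \<le> sum l B"
    using ex_is_arg_min_if_finite[of \<A> "sum l"] by (auto simp: is_arg_min_linorder)
  then obtain par dep where tree: "rooted_tree G l r par dep" "(fst \<circ> par) ` (verts G - {r}) \<subseteq> A"
    using rooted_tree_exists[OF r, of A] by (auto simp: \<A>_def)
  have "A \<subseteq> arcs G" using A by (auto simp: \<A>_def spans_def)
  then have "sum l ((fst \<circ> par) ` (verts G - {r})) \<le> sum l A"
    using len_pos by (intro sum_mono2 tree finite_subset[OF \<open>A \<subseteq> arcs G\<close>]) (auto intro: less_imp_le)
  then have "sum l ((fst \<circ> par) ` (verts G - {r})) \<le> sum l B" if "spans r B" for B
    using A(2)[of B] that by (auto simp: \<A>_def)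
  then show thesis using minimal_tree_short_loop[OF tree(1) refl] by (intro that[OF tree(1)]) auto
qed

text \<open>Handshake count: every edge, loop or not, enters one vertex and leaves one
  vertex.\<close>

lemma sum_valence: "(\<Sum>v\<in>verts G. valence G v) = 2 * card (arcs G)"
proof -
  have "(\<Sum>v\<in>verts G. in_degree G v) = card (\<Union>v\<in>verts G. in_arcs G v)"
    unfolding in_degree_def by (subst card_UN_disjoint) (auto simp: in_arcs_def)
  also have "(\<Union>v\<in>verts G. in_arcs G v) = arcs G" by (auto simp: in_arcs_def)
  finally have 1: "(\<Sum>v\<in>verts G. in_degree G v) = card (arcs G)" .
  have "(\<Sum>v\<in>verts G. out_degree G v) = card (\<Union>v\<in>verts G. out_arcs G v)"
    unfolding out_degree_def by (subst card_UN_disjoint) (auto simp: out_arcs_def)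
  also have "(\<Union>v\<in>verts G. out_arcs G v) = arcs G" by (auto simp: out_arcs_def)
  finally show ?thesis using 1 by (simp add: valence_def sum.distrib)
qed

text \<open>The first Betti number is \<open>b = |E| - |V| + 1\<close>, written without subtraction.\<close>

lemma homotopy_equivalent_rose:
  assumes "card (arcs G) + 1 = b + card (verts G)"
  shows "X homotopy_equivalent_space unit_rose b"
proof -
  obtain r par dep where "rooted_tree G l r par dep" using good_tree_exists by metis
  then interpret rooted_tree G l r par dep .
  have "0 < card (verts G)" using root by (auto simp: card_gt_0_iff)
  then have "card (arcs G) - card T = b" using assms card_T by simp
  then obtain \<beta> where "marked_tree G l r par dep b \<beta>" using marking_exists by blast
  then interpret marked_tree G l r par dep b \<beta> .
  show ?thesis
    using collapse_equivalence
    unfolding homotopy_equivalence_map_def homotopy_equivalent_space_def by blast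
qed

end

section \<open>The upper bound\<close>

lemma thick_part_marked_tree:
  assumes "(G, l) \<in> thick_part n \<epsilon>" "0 < \<epsilon>" "1 \<le> n"
  shows "\<exists>r par dep \<beta>. marked_tree G l r par dep n \<beta> \<and>
    (\<forall>e\<in>arcs G - (fst \<circ> par) ` (verts G - {r}). \<epsilon> / (2 * real n) \<le> l e)"
proof -
  have mod: "metric_graph G l" "realization G l homotopy_equivalent_space unit_rose n"
    "\<And>v. v \<in> verts G \<Longrightarrow> 3 \<le> valence G v"
    and thick: "\<And>p. is_loop G p \<Longrightarrow> \<epsilon> \<le> path_length l p"
    using assms by (auto simp: thick_part_def moduli_space_def)
  interpret mgraph G l by unfold_locales (rule mod)
  obtain r par dep where tree: "rooted_tree G l r par dep"
    "\<And>f. f \<in> arcs G - (fst \<circ> par) ` (verts G - {r}) \<Longrightarrow>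
       \<exists>p. is_loop G p \<and> path_length l p \<le> real (card (verts G)) * l f"
    using good_tree_exists by metis
  interpret rooted_tree G l r par dep by fact
  let ?k = "card (arcs G) - card T"
  obtain \<beta> where marked: "marked_tree G l r par dep ?k \<beta>" using marking_exists by blast
  interpret marked_tree G l r par dep ?k \<beta> by fact
  have "X homotopy_equivalent_space unit_rose ?k"
    using collapse_equivalence
    unfolding homotopy_equivalence_map_def homotopy_equivalent_space_def by blast
  \<comment> \<open>The roses with \<open>?k\<close> and with \<open>n\<close> petals are both
    equivalent to the graph.\<close>
  from homotopy_eqv_trans[OF homotopy_equivalent_space_sym[THEN iffD1, OF this] mod(2)]
  have k: "?k = n" by (rule rose_rank_unique)
  \<comment> \<open>Three times the number of vertices is at most twice the number of edges, which
    is \<open>card (verts G) + n - 1\<close>; this leaves at most \<open>2 * n - 2\<close>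
    vertices.\<close>
  have "3 * card (verts G) \<le> (\<Sum>v\<in>verts G. valence G v)"
    using sum_bounded_below[of "verts G" 3 "valence G"] mod(3) by (simp add: mult.commute)
  moreover have "0 < card (verts G)" using root by (auto simp: card_gt_0_iff)
  ultimately have V: "card (verts G) \<le> 2 * n"
    using k card_T assms(3) card_mono[OF _ T_arcs] unfolding sum_valence by simp
  have "\<epsilon> / (2 * real n) \<le> l e" if e: "e \<in> arcs G - (fst \<circ> par) ` (verts G - {r})" for e
  proof -
    obtain p where "is_loop G p" "path_length l p \<le> real (card (verts G)) * l e"
      using tree(2)[OF e] by blast
    then have "\<epsilon> \<le> real (card (verts G)) * l e" using thick by fastforce
    also have "\<dots> \<le> real (2 * n) * l e" using V len_pos[of e] e by (intro mult_right_mono) auto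
    finally show ?thesis using assms(3) by (simp add: field_simps)
  qed
  moreover have "marked_tree G l r par dep n \<beta>" using marked unfolding k .
  ultimately show ?thesis by blast
qed

lemma lipschitz_dist_le:
  assumes G: "(G, l) \<in> thick_part n \<epsilon>" and H: "(H, m) \<in> thick_part n \<epsilon>" and "0 < \<epsilon>" "1 \<le> n"
  shows "lipschitz_dist (G, l) (H, m) \<le> ereal (ln (6 * real n ^ 2 / \<epsilon>))"
proof -
  obtain r par dep \<beta> where A: "marked_tree G l r par dep n \<beta>"
    "\<forall>e\<in>arcs G - (fst \<circ> par) ` (verts G - {r}). \<epsilon> / (2 * real n) \<le> l e"
    using thick_part_marked_tree[OF G] assms by blast
  obtain r' par' dep' \<beta>' where B: "marked_tree H m r' par' dep' n \<beta>'"
    using thick_part_marked_tree[OF H] assms by blast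
  interpret G: marked_tree G l r par dep n \<beta> by (rule A)
  interpret H: marked_tree H m r' par' dep' n \<beta>' by (rule B)
  \<comment> \<open>The volume makes \<open>H.expand\<close> \<open>3 * n\<close>-Lipschitz;
    multiplied by the stretch \<open>2 * n / \<epsilon>\<close> of the collapse, this gives the
    constant.\<close>
  have "volume H m = real n" using H by (auto simp: thick_part_def moduli_space_def)
  then have L2: "lipschitz_map (3 * real n) (points (rose n) (\<lambda>_. 1)) (path_dist (rose n) (\<lambda>_. 1))
    (points H m) (path_dist H m) H.expand"
    using H.petal_len_le by (intro H.expand_lipschitz) auto
  have L1: "lipschitz_map (1 / (\<epsilon> / (2 * real n))) (points G l) (path_dist G l)
    (points (rose n) (\<lambda>_. 1)) (path_dist (rose n) (\<lambda>_. 1)) G.collapse"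
    using A(2) assms by (intro G.collapse_lipschitz) (auto simp: image_image)
  have "lipschitz_map (6 * real n ^ 2 / \<epsilon>) (points G l) (path_dist G l)
    (points H m) (path_dist H m) (H.expand \<circ> G.collapse)"
    using lipschitz_map_comp[OF L1 L2] by (simp add: power2_eq_square)
  moreover have "homotopy_equivalence_map (realization G l) (realization H m) (H.expand \<circ> G.collapse)"
    using homotopy_equivalence_map_comp[OF G.collapse_equivalence H.expand_equivalence] .
  moreover have "0 < 6 * real n ^ 2 / \<epsilon>" using assms by simp
  ultimately have "0 < 6 * real n ^ 2 / \<epsilon> \<and>
      homotopy_equivalence_map (realization G l) (realization H m) (H.expand \<circ> G.collapse) \<and>
      lipschitz_map (6 * real n ^ 2 / \<epsilon>) (points G l) (path_dist G l) (points H m) (path_dist H m)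
        (H.expand \<circ> G.collapse)"
    by simp
  then show ?thesis
    unfolding lipschitz_dist_def prod.case by (intro Inf_lower) blast
qed

subsection \<open>Lower bounds for Lipschitz constants\<close>

text \<open>Collapsing everything outside the segments from \<open>a\<close> to \<open>b\<close> to
  the base point is homotopic to the identity. If the image of the loop avoided these segments, it
  would become constant, whereas \<open>g \<circ> f\<close> being homotopic to the identity forces
  \<open>wrap l e \<circ> g\<close> to wind once along it.\<close>

lemma homotopy_equivalence_loop_enters:
  assumes "mgraph G l" and f: "homotopy_equivalence_map (realization G l) (unit_rose n) f"
    and e: "e \<in> arcs G" "tail G e = head G e" and ab: "0 \<le> a" "a < b" "b \<le> 1"
  shows "\<exists>t\<in>{0..1}. \<exists>j s. f (mgraph.loop_at G l e t) = Interior j s \<and> a < s \<and> s < b"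
proof (rule ccontr)
  assume avoid: "\<not> ?thesis"
  interpret mgraph G l by fact
  obtain g where fg: "continuous_map X (unit_rose n) f" "continuous_map (unit_rose n) X g"
    "homotopic_with (\<lambda>_. True) X X (g \<circ> f) id"
    using f unfolding homotopy_equivalence_map_def by blast
  define \<kappa> :: "(nat, nat) gpoint \<Rightarrow> (nat, nat) gpoint" where
    "\<kappa> = (\<lambda>x. case x of Vertex v \<Rightarrow> Vertex 0
      | Interior j s \<Rightarrow> edge_pt (rose n) (\<lambda>_. 1) j ((s - a) / (b - a)))"
  have \<kappa>: "homotopic_with (\<lambda>_. True) (unit_rose n) (unit_rose n) \<kappa> id"
    by (rule rose_reparametrization[where \<alpha> = "\<lambda>_ s. (s - a) / (b - a)"])
      (use ab in \<open>auto simp: \<kappa>_def divide_simps intro!: continuous_intros\<close>)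
  let ?q = "wrap l e"
  have qg: "continuous_map (unit_rose n) punctured_plane (?q \<circ> g)"
    using fg(2) continuous_map_wrap[OF e(1)] by (rule continuous_map_compose)
  have fc: "continuous_map (top_of_set {0..1}) (unit_rose n) (f \<circ> loop_at e)"
    "(f \<circ> loop_at e) 0 = (f \<circ> loop_at e) 1"
    using continuous_map_compose[OF loop_at(1)[OF e] fg(1)] loop_at(2)[OF e] by simp_all
  have "homotopic_with (\<lambda>_. True) (unit_rose n) punctured_plane ((?q \<circ> g) \<circ> \<kappa>) ((?q \<circ> g) \<circ> id)"
    by (rule homotopic_with_compose_continuous_map_left[OF \<kappa> qg]) simp
  note W = this homotopic_with_winding_number[OF this fc]
  have "homotopic_with (\<lambda>_. True) X punctured_plane (?q \<circ> (g \<circ> f)) (?q \<circ> id)"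
    by (rule homotopic_with_compose_continuous_map_left[OF fg(3) continuous_map_wrap[OF e(1)]]) simp
  from homotopic_with_winding_number[OF this loop_at[OF e]] winding_number_wrap_loop[OF e]
  have one: "winding_number (((?q \<circ> g) \<circ> \<kappa>) \<circ> (f \<circ> loop_at e)) 0 = 1"
    using W(2) by (simp add: o_def)
  have const: "(((?q \<circ> g) \<circ> \<kappa>) \<circ> (f \<circ> loop_at e)) t = exp (Ln (?q (g (Vertex 0))))" if t: "t \<in> {0..1}" for t
  proof -
    have "\<kappa> (f (loop_at e t)) = Vertex 0"
    proof (cases "f (loop_at e t)")
      case (Interior j s)
      then have "s \<le> a \<or> b \<le> s" using avoid t by force
      then show ?thesis using Interior ab by (auto simp: \<kappa>_def edge_pt_def field_simps)
    qed (simp add: \<kappa>_def)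
    then show ?thesis by simp
  qed
  have "path (((?q \<circ> g) \<circ> \<kappa>) \<circ> (f \<circ> loop_at e))"
    using homotopic_with_imp_continuous_maps[OF W(1)] by (intro punctured_plane_path(1)[OF _ fc(1)]) simp
  from winding_number_exp[OF this _ const]
  have "2 * of_real pi * \<i> * winding_number (((?q \<circ> g) \<circ> \<kappa>) \<circ> (f \<circ> loop_at e)) 0 = 0"
    by (simp only: path_def continuous_on_const diff_self)
  then show False using one by simp
qed

text \<open>A closed path with one edge is a loop edge, of length at least
  \<open>\<epsilon>\<close>; any longer one has at least two edges, each of length at least
  \<open>\<epsilon> / 2\<close>.\<close>

lemma thick_partI:
  assumes mg: "metric_graph G l" and betti: "card (arcs G) + 1 = n + card (verts G)"
    and val: "\<And>v. v \<in> verts G \<Longrightarrow> 3 \<le> valence G v" and vol: "volume G l = real n"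
    and edges: "\<And>e. e \<in> arcs G \<Longrightarrow> (if tail G e = head G e then \<epsilon> else \<epsilon> / 2) \<le> l e" and "0 < \<epsilon>"
  shows "(G, l) \<in> thick_part n \<epsilon>"
proof -
  interpret mgraph G l by unfold_locales (rule mg)
  have "\<epsilon> \<le> path_length l p" if p: "is_loop G p" for p
  proof -
    obtain u where u: "edge_path G u p u" and "p \<noteq> []" using p by (auto simp: is_loop_def)
    have half: "\<epsilon> / 2 \<le> l e" if "e \<in> arcs G" for e
      using edges[OF that] \<open>0 < \<epsilon>\<close> by (auto split: if_splits)
    obtain e b q where eq: "p = (e, b) # q" using \<open>p \<noteq> []\<close> by (cases p) auto
    have "(e, b) \<in> arcs (oriented G) \<and> tail (oriented G) (e, b) = u \<and> edge_path G (head (oriented G) (e, b)) q u"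
      using u unfolding eq O.awalk_Cons_iff by blast
    then have q: "e \<in> arcs G" "edge_path G (head (oriented G) (e, b)) q u" "tail (oriented G) (e, b) = u"
      by simp_all
    show ?thesis
    proof (cases q)
      case Nil
      then have "tail G e = head G e" using q by (auto simp: O.awalk_Nil_iff split: if_splits)
      then show ?thesis using edges[OF q(1)] eq Nil by simp
    next
      case (Cons a q')
      then have "fst a \<in> arcs G" "edge_path G (head (oriented G) a) q' u"
        using q(2) by (auto simp: O.awalk_Cons_iff)
      then show ?thesis
        using half[OF q(1)] half[of "fst a"] path_length_nonneg[OF mg] eq Cons by fastforce
    qed
  qed
  then show ?thesis
    using homotopy_equivalent_rose[OF betti] mg val vol by (auto simp: thick_part_def moduli_space_def)
qed

lemma lipschitz_dist_ge:
  assumes "0 < c"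
    and "\<And>L f. \<lbrakk>0 < L; homotopy_equivalence_map (realization G l) (realization H m) f;
       lipschitz_map L (points G l) (path_dist G l) (points H m) (path_dist H m) f\<rbrakk> \<Longrightarrow> c \<le> L"
  shows "ereal (ln c) \<le> lipschitz_dist (G, l) (H, m)"
  unfolding lipschitz_dist_def prod.case by (rule Inf_greatest) (use assms in auto)

subsection \<open>A pair with a short loop\<close>

text \<open>The other petals share the remaining volume equally; for
  \<open>\<epsilon> \<le> 1\<close> their length is at least 1.\<close>

definition pinched_len :: "nat \<Rightarrow> real \<Rightarrow> nat \<Rightarrow> real" where
  "pinched_len n \<epsilon> i = (if i = 0 then \<epsilon> else (real n - \<epsilon>) / (real n - 1))"

lemma rose_valence: "valence (rose n) 0 = 2 * n"
proof -
  have "in_arcs (rose n) 0 = {..<n}" "out_arcs (rose n) 0 = {..<n}"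
    by (auto simp: in_arcs_def out_arcs_def)
  then show ?thesis by (simp add: valence_def in_degree_def out_degree_def)
qed

lemma pinched_rose_thick:
  assumes "2 \<le> n" "0 < \<epsilon>" "\<epsilon> \<le> 1"
  shows "(rose n, pinched_len n \<epsilon>) \<in> thick_part n \<epsilon>"
proof (rule thick_partI)
  have ge: "\<epsilon> \<le> (real n - \<epsilon>) / (real n - 1)"
    using assms mult_right_mono[of \<epsilon> 1 "real n"] by (simp add: field_simps)
  show "metric_graph (rose n) (pinched_len n \<epsilon>)"
    using mgraph_rose[of n "pinched_len n \<epsilon>"] assms by (simp add: pinched_len_def mgraph_def)
  have "{..<n} = insert 0 {1..<n}" using assms by auto
  then show "volume (rose n) (pinched_len n \<epsilon>) = real n"
    using assms by (simp add: volume_def pinched_len_def of_nat_diff)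
  show "(if tail (rose n) e = head (rose n) e then \<epsilon> else \<epsilon> / 2) \<le> pinched_len n \<epsilon> e" for e
    using ge by (simp add: pinched_len_def)
  show "3 \<le> valence (rose n) v" if "v \<in> verts (rose n)" for v
    using that rose_valence[of n] assms by simp
qed (use assms in auto)

text \<open>The image of the short loop must meet the middle of a petal as well as a segment next to
  the base point; with a small Lipschitz constant it cannot reach both.\<close>

lemma pinched_rose_dist:
  assumes "2 \<le> n" "0 < \<epsilon>" "\<epsilon> \<le> 1"
  shows "ereal (ln (1 / (4 * \<epsilon>))) \<le> lipschitz_dist (rose n, pinched_len n \<epsilon>) (rose n, \<lambda>_. 1)"
proof (rule lipschitz_dist_ge)
  fix L f
  assume L: "0 < L"
    and f: "homotopy_equivalence_map (realization (rose n) (pinched_len n \<epsilon>)) (unit_rose n) f"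
    and lip: "lipschitz_map L (points (rose n) (pinched_len n \<epsilon>)) (path_dist (rose n) (pinched_len n \<epsilon>))
        (points (rose n) (\<lambda>_. 1)) (path_dist (rose n) (\<lambda>_. 1)) f"
  let ?l = "pinched_len n \<epsilon>"
  interpret P: mgraph "rose n" ?l
    using assms by (intro mgraph_rose) (auto simp: pinched_len_def)
  let ?c = "P.loop_at 0"
  show "1 / (4 * \<epsilon>) \<le> L"
  proof (rule ccontr)
    assume "\<not> 1 / (4 * \<epsilon>) \<le> L"
    \<comment> \<open>Points of the loop are within \<open>\<epsilon> / 2\<close> of its vertex, so
      their images are within \<open>1 / 8\<close> of one point; this is where the 4 comes
      from.\<close>
    then have small: "L * (\<epsilon> / 2) < 1 / 8" using assms by (simp add: field_simps)
    have l0: "?l 0 = \<epsilon>" by (simp add: pinched_len_def)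
    have c_in: "?c t \<in> points (rose n) ?l" for t using assms by (simp add: P.loop_at_def)
    have c0: "?c 0 = Vertex 0" by (simp add: P.loop_at_def edge_pt_def)
    have c_dist: "path_dist (rose n) ?l (?c t) (?c 0) \<le> \<epsilon> / 2" if t: "t \<in> {0..1}" for t
    proof -
      have "0 \<le> t * \<epsilon>" "t * \<epsilon> \<le> \<epsilon>" using t assms by (auto simp: mult_left_le_one_le)
      then have "path_dist (rose n) ?l (edge_pt (rose n) ?l 0 (t * \<epsilon>)) (Vertex 0) \<le> \<epsilon> / 2"
        using P.edge_pt_route[of 0 "t * \<epsilon>"] assms
          P.M.commute[of "edge_pt (rose n) ?l 0 (t * \<epsilon>)" "Vertex 0"] l0 by simp
      moreover have "?c t = edge_pt (rose n) ?l 0 (t * \<epsilon>)" by (simp add: P.loop_at_def l0)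
      ultimately show ?thesis by (simp only: c0)
    qed
    \<comment> \<open>The distance to the base point of the unit rose, a 1-Lipschitz
      function.\<close>
    define \<rho> where "\<rho> x = (case x of Vertex (_::nat) \<Rightarrow> 0 | Interior (j::nat) s \<Rightarrow> min s (1 - s))" for x :: "(nat, nat) gpoint"
    have \<rho>_edge: "\<rho> (edge_pt (rose n) (\<lambda>_. 1) j s) = min s (1 - s)" if "0 \<le> s" "s \<le> 1" for j s
      using that by (auto simp: \<rho>_def edge_pt_def)
    have "lipschitz_map 1 (points (rose n) (\<lambda>_. 1)) (path_dist (rose n) (\<lambda>_. 1)) UNIV dist \<rho>"
      by (rule R.lipschitz_map_by_edges[OF Met_TC.Metric_space_axioms]) (auto simp: \<rho>_edge dist_real_def)
    then have \<rho>_lip: "dist (\<rho> x) (\<rho> y) \<le> path_dist (rose n) (\<lambda>_. 1) x y"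
      if "x \<in> points (rose n) (\<lambda>_. 1)" "y \<in> points (rose n) (\<lambda>_. 1)" for x y
      using that by (simp add: lipschitz_map_def)
    have close: "\<bar>\<rho> (f (?c t)) - \<rho> (f (?c 0))\<bar> < 1 / 8" if t: "t \<in> {0..1}" for t
    proof -
      have "\<bar>\<rho> (f (?c t)) - \<rho> (f (?c 0))\<bar> \<le> path_dist (rose n) (\<lambda>_. 1) (f (?c t)) (f (?c 0))"
        using \<rho>_lip[of "f (?c t)" "f (?c 0)"] lip c_in by (auto simp: lipschitz_map_def dist_real_def)
      also have "\<dots> \<le> L * path_dist (rose n) ?l (?c t) (?c 0)"
        using lip c_in by (auto simp: lipschitz_map_def)
      also have "\<dots> \<le> L * (\<epsilon> / 2)" using c_dist[OF t] L by (intro mult_left_mono) auto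
      finally show ?thesis using small by simp
    qed
    note enters = homotopy_equivalence_loop_enters[OF P.mgraph_axioms f, of 0]
    show False
    \<comment> \<open>If the vertex lands near the base point, the segment from \<open>3 / 8\<close>
      to \<open>5 / 8\<close> is out of reach; otherwise the segment from 0 to \<open>1 / 8\<close>
      is.\<close>
    proof (cases "\<rho> (f (?c 0)) \<le> 1 / 4")
      case True
      obtain t j s where "t \<in> {0..1}" "f (?c t) = Interior j s" "3 / 8 < s" "s < 5 / 8"
        using enters[of "3 / 8" "5 / 8"] assms by auto
      moreover from this have "3 / 8 < \<rho> (f (?c t))" by (simp add: \<rho>_def)
      ultimately show False using close[of t] True by linarith
    next
      case False
      obtain t j s where "t \<in> {0..1}" "f (?c t) = Interior j s" "0 < s" "s < 1 / 8"
        using enters[of 0 "1 / 8"] assms by auto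
      moreover from this have "\<rho> (f (?c t)) < 1 / 8" by (simp add: \<rho>_def)
      ultimately show False using close[of t] False by linarith
    qed
  qed
qed (use assms in simp)

subsection \<open>A pair with very different diameters\<close>

definition theta :: "nat \<Rightarrow> (nat, nat) pre_digraph" where
  "theta n = \<lparr> verts = {0, 1}, arcs = {..n}, tail = (\<lambda>_. 0), head = (\<lambda>_. 1) \<rparr>"

text \<open>The common length of \<open>n + 1\<close> edges of total volume
  \<open>n\<close>.\<close>

definition theta_len :: "nat \<Rightarrow> nat \<Rightarrow> real" where
  "theta_len n e = real n / (real n + 1)"

lemma theta_simps [simp]:
  "verts (theta n) = {0, 1}" "arcs (theta n) = {..n}" "tail (theta n) e = 0" "head (theta n) e = 1"
  by (simp_all add: theta_def)

lemma mgraph_theta: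
  assumes "1 \<le> n" shows "mgraph (theta n) (theta_len n)"
proof -
  have fin: "fin_digraph (theta n)" by unfold_locales auto
  interpret O: wf_digraph "oriented (theta n)" by unfold_locales (auto split: if_splits)
  have "edge_path (theta n) 0 [(0, True)] 1" "edge_path (theta n) 1 [(0, False)] 0"
    "edge_path (theta n) 0 [] 0" "edge_path (theta n) 1 [] 1"
    by (simp_all add: O.awalk_Cons_iff O.awalk_Nil_iff)
  then have "strongly_connected (oriented (theta n))"
    by (auto simp: strongly_connected_def O.reachable_awalk)
  then show ?thesis using fin assms by (simp add: mgraph_def metric_graph_def theta_len_def)
qed

lemma theta_thick:
  assumes "2 \<le> n" "0 < \<epsilon>" "\<epsilon> \<le> 1"
  shows "(theta n, theta_len n) \<in> thick_part n \<epsilon>"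
proof (rule thick_partI)
  interpret mgraph "theta n" "theta_len n" using assms by (intro mgraph_theta) simp
  show "metric_graph (theta n) (theta_len n)" by (rule mg)
  have "out_arcs (theta n) 0 = {..n}" "in_arcs (theta n) 1 = {..n}"
    by (auto simp: in_arcs_def out_arcs_def)
  then show "3 \<le> valence (theta n) v" if "v \<in> verts (theta n)" for v
    using that assms by (auto simp: valence_def in_degree_def out_degree_def)
  show "volume (theta n) (theta_len n) = real n"
    using assms by (simp add: volume_def theta_len_def field_simps)
  show "(if tail (theta n) e = head (theta n) e then \<epsilon> else \<epsilon> / 2) \<le> theta_len n e" for e
  proof -
    have "\<epsilon> / 2 \<le> 1 / 2" using assms by simp
    also have "\<dots> \<le> real n / (real n + 1)" using assms by (simp add: field_simps)
    finally have "\<epsilon> / 2 \<le> theta_len n e" by (simp only: theta_len_def)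
    then show ?thesis by simp
  qed
qed (use assms in auto)

text \<open>The routes from \<open>x\<close> to \<open>y\<close> through the two vertices add up to
  at most twice the edge length, so one of them is at most one edge long.\<close>

lemma theta_diameter:
  assumes n: "1 \<le> n" and x: "x \<in> points (theta n) (theta_len n)" and y: "y \<in> points (theta n) (theta_len n)"
  shows "path_dist (theta n) (theta_len n) x y \<le> real n / (real n + 1)"
proof -
  interpret mgraph "theta n" "theta_len n" using n by (rule mgraph_theta)
  let ?d = "path_dist (theta n) (theta_len n)" and ?l = "real n / (real n + 1)"
  have ex: "\<exists>\<rho>. ?d z (Vertex 0) \<le> \<rho> \<and> ?d z (Vertex 1) \<le> ?l - \<rho>"
    if z: "z \<in> points (theta n) (theta_len n)" for z
  proof -
    have "\<exists>e t. e \<in> arcs (theta n) \<and> 0 \<le> t \<and> t \<le> theta_len n e \<and> z = edge_pt (theta n) (theta_len n) e t"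
      using z
    proof (cases rule: edge_pt_surj)
      case (1 v)
      then have "z = edge_pt (theta n) (theta_len n) 0 0 \<or> z = edge_pt (theta n) (theta_len n) 0 (theta_len n 0)"
        using edge_pt_ends[of 0] by auto
      moreover have "0 \<le> theta_len n 0" by (simp add: theta_len_def)
      ultimately show ?thesis by (metis theta_simps(2) atMost_iff le0 order_refl)
    next
      case (2 e t)
      then show ?thesis by (intro exI[of _ e] exI[of _ t]) auto
    qed
    then obtain e t where "e \<in> arcs (theta n)" "0 \<le> t" "t \<le> theta_len n e" "z = edge_pt (theta n) (theta_len n) e t"
      by blast
    then show ?thesis
      using edge_pt_route[of e t] M.commute[of z "Vertex 0"]
      by (intro exI[of _ t]) (simp add: theta_len_def)
  qed
  obtain a where a: "?d x (Vertex 0) \<le> a" "?d x (Vertex 1) \<le> ?l - a" using ex[OF x] by blast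
  obtain b where b: "?d y (Vertex 0) \<le> b" "?d y (Vertex 1) \<le> ?l - b" using ex[OF y] by blast
  have "?d x y \<le> ?d x (Vertex 0) + ?d (Vertex 0) y" "?d x y \<le> ?d x (Vertex 1) + ?d (Vertex 1) y"
    using x y by (auto intro!: M.triangle)
  then have "?d x y \<le> a + b" "?d x y \<le> 2 * ?l - a - b"
    using a b M.commute[of y] by auto
  then show ?thesis by linarith
qed

text \<open>A chain of vertices \<open>0, \<dots>, n - 2\<close>, consecutive ones joined by two edges, with a loop at either
  end. The loops are the edges \<open>0\<close> and \<open>2 * n - 3\<close>; truncated subtraction gives \<open>tail 0 = 0\<close>.\<close>

definition chain :: "nat \<Rightarrow> (nat, nat) pre_digraph" where
  "chain n = \<lparr> verts = {..<n - 1}, arcs = {..<2 * n - 2}, tail = (\<lambda>e. (e - 1) div 2),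
     head = (\<lambda>e. min ((e + 1) div 2) (n - 2)) \<rparr>"

text \<open>Two loops of length 1 and \<open>2 * n - 4\<close> edges of length \<open>1 / 2\<close>
  have total volume \<open>n\<close>.\<close>

definition chain_len :: "nat \<Rightarrow> nat \<Rightarrow> real" where
  "chain_len n e = (if e = 0 \<or> e = 2 * n - 3 then 1 else 1 / 2)"

lemma chain_simps [simp]:
  "verts (chain n) = {..<n - 1}" "arcs (chain n) = {..<2 * n - 2}" "tail (chain n) e = (e - 1) div 2"
  "head (chain n) e = min ((e + 1) div 2) (n - 2)"
  by (simp_all add: chain_def)

lemma mgraph_chain:
  assumes n: "2 \<le> n" shows "mgraph (chain n) (chain_len n)"
proof -
  have fin: "fin_digraph (chain n)" using n by unfold_locales auto
  interpret O: wf_digraph "oriented (chain n)" using n by unfold_locales (auto split: if_splits)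
  have "\<exists>p. edge_path (chain n) 0 p v" "\<exists>p. edge_path (chain n) v p 0" if "v < n - 1" for v
    using that
  proof (induction v)
    case 0
    {
      case 1
      show ?case using n by (intro exI[of _ "[]"]) (simp add: O.awalk_Nil_iff)
    next
      case 2
      show ?case using n by (intro exI[of _ "[]"]) (simp add: O.awalk_Nil_iff)
    }
  next
    case (Suc v)
    {
      case 1
      then obtain p where p: "edge_path (chain n) 0 p v" using Suc.IH(1) by auto
      \<comment> \<open>Edge \<open>2 * v + 1\<close> is one of the two edges from \<open>v\<close>
        to \<open>Suc v\<close>.\<close>
      have "edge_path (chain n) v [(2 * v + 1, True)] (Suc v)"
        using 1 by (simp add: O.awalk_Cons_iff O.awalk_Nil_iff)
      then show ?case using O.awalk_appendI[OF p] by blast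
    next
      case 2
      then obtain p where p: "edge_path (chain n) v p 0" using Suc.IH(2) by auto
      have "edge_path (chain n) (Suc v) [(2 * v + 1, False)] v"
        using 2 by (simp add: O.awalk_Cons_iff O.awalk_Nil_iff)
      then show ?case using O.awalk_appendI[OF _ p] by blast
    }
  qed
  then have "\<exists>p. edge_path (chain n) u p v" if "u < n - 1" "v < n - 1" for u v
    using that O.awalk_appendI by meson
  moreover have "verts (chain n) \<noteq> {}" using n by (simp add: lessThan_empty_iff)
  ultimately have "strongly_connected (oriented (chain n))"
    by (auto simp: strongly_connected_def O.reachable_awalk)
  then show ?thesis using fin by (simp add: mgraph_def metric_graph_def chain_len_def)
qed

lemma chain_thick:
  assumes n: "2 \<le> n" and "0 < \<epsilon>" "\<epsilon> \<le> 1"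
  shows "(chain n, chain_len n) \<in> thick_part n \<epsilon>"
proof (rule thick_partI)
  interpret mgraph "chain n" "chain_len n" using n by (rule mgraph_chain)
  show "metric_graph (chain n) (chain_len n)" by (rule mg)
  show "card (arcs (chain n)) + 1 = n + card (verts (chain n))" using n by simp
  show "3 \<le> valence (chain n) v" if v: "v \<in> verts (chain n)" for v
  proof -
    \<comment> \<open>Three half-edges at \<open>v\<close>: the loop at 0 counts as incoming and as
      outgoing, and at the last vertex the edge \<open>2 * v + 1\<close> is the other loop.\<close>
    let ?o = "if v = 0 then {0, 1} else {2 * v + 1}" and ?i = "if v = 0 then {0} else {2 * v - 1, 2 * v}"
    have "?o \<subseteq> out_arcs (chain n) v" using v n by (auto simp: out_arcs_def)
    then have "card ?o \<le> out_degree (chain n) v"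
      unfolding out_degree_def by (rule card_mono[OF finite_out_arcs])
    moreover have "?i \<subseteq> in_arcs (chain n) v" using v n by (auto simp: in_arcs_def)
    then have "card ?i \<le> in_degree (chain n) v"
      unfolding in_degree_def by (rule card_mono[OF finite_in_arcs])
    moreover have "card ?i + card ?o = 3" by (simp add: card_insert_if)
    ultimately show ?thesis by (simp only: valence_def)
  qed
  have len: "chain_len n e = 1 / 2 + (if e = 0 then 1 / 2 else 0) + (if e = 2 * n - 3 then 1 / 2 else 0)" for e
    using n by (simp add: chain_len_def)
  show "volume (chain n) (chain_len n) = real n"
  proof -
    have "2 * n - 3 < 2 * n - 2" "0 < 2 * n - 2" using n by auto
    then show ?thesis
      using n unfolding volume_def len sum.distrib by (simp add: sum.delta of_nat_diff field_simps)
  qed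
  show "(if tail (chain n) e = head (chain n) e then \<epsilon> else \<epsilon> / 2) \<le> chain_len n e" if "e \<in> arcs (chain n)" for e
  proof -
    have "e = 0 \<or> e = 2 * n - 3" if "tail (chain n) e = head (chain n) e"
      using that \<open>e \<in> arcs (chain n)\<close> n by (auto simp: min_def split: if_splits)
    then show ?thesis using assms by (auto simp: chain_len_def)
  qed
qed (use assms in auto)

lemma theta_chain_dist:
  assumes n: "2 \<le> n"
  shows "ereal (ln ((real n + 1) / 2)) \<le> lipschitz_dist (theta n, theta_len n) (chain n, chain_len n)"
proof (rule lipschitz_dist_ge)
  fix L f
  assume L: "0 < L"
    and f: "homotopy_equivalence_map (realization (theta n) (theta_len n)) (realization (chain n) (chain_len n)) f"
    and lip: "lipschitz_map L (points (theta n) (theta_len n)) (path_dist (theta n) (theta_len n))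
        (points (chain n) (chain_len n)) (path_dist (chain n) (chain_len n)) f"
  interpret G: mgraph "theta n" "theta_len n" using n by (intro mgraph_theta) simp
  interpret H: mgraph "chain n" "chain_len n" using n by (rule mgraph_chain)
  \<comment> \<open>A height along the chain: consecutive vertices are \<open>1 / 2\<close> apart
    and the end loops are folded outwards, which puts their midpoints at \<open>- 1 / 2\<close> and
    \<open>(n - 1) / 2\<close>.\<close>
  define pos where "pos e t = (if e = 0 then - min t (1 - t)
     else if e = 2 * n - 3 then (real n - 2) / 2 + min t (1 - t) else real ((e - 1) div 2) / 2 + t)" for e t
  define \<phi> where "\<phi> x = (case x of Vertex v \<Rightarrow> real v / 2 | Interior e t \<Rightarrow> pos e t)" for x :: "(nat, nat) gpoint"
  have \<phi>: "\<phi> (edge_pt (chain n) (chain_len n) e t) = pos e t"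
    if e: "e < 2 * n - 2" and t: "0 \<le> t" "t \<le> chain_len n e" for e t
  proof -
    consider "e = 0" | "e = 2 * n - 3" "e \<noteq> 0" | "e \<noteq> 0" "e \<noteq> 2 * n - 3" by blast
    then show ?thesis
    proof cases
      case 1
      then show ?thesis using t n by (auto simp: \<phi>_def pos_def edge_pt_def chain_len_def)
    next
      case 2
      then have "(e - 1) div 2 = n - 2" "min ((e + 1) div 2) (n - 2) = n - 2" using n by auto
      then show ?thesis using 2 t n by (auto simp: \<phi>_def pos_def edge_pt_def chain_len_def of_nat_diff)
    next
      case 3
      then have "min ((e + 1) div 2) (n - 2) = Suc ((e - 1) div 2)" using e n by (auto simp: min_def)
      then show ?thesis using 3 t n by (auto simp: \<phi>_def pos_def edge_pt_def chain_len_def)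
    qed
  qed
  have "lipschitz_map 1 (points (chain n) (chain_len n)) (path_dist (chain n) (chain_len n)) UNIV dist \<phi>"
    by (rule H.lipschitz_map_by_edges[OF Met_TC.Metric_space_axioms])
      (auto simp: \<phi> dist_real_def pos_def)
  then have \<phi>_lip: "\<bar>\<phi> x - \<phi> y\<bar> \<le> path_dist (chain n) (chain_len n) x y"
    if "x \<in> points (chain n) (chain_len n)" "y \<in> points (chain n) (chain_len n)" for x y
    using that by (simp add: lipschitz_map_def dist_real_def)
  let ?e = "2 * n - 3"
  have "(?e - 1) div 2 = n - 2" "min ((?e + 1) div 2) (n - 2) = n - 2" using n by auto
  then have "Interior 0 (1 / 2) \<in> f ` topspace G.X" "Interior ?e (1 / 2) \<in> f ` topspace G.X"
    using n by (intro H.homotopy_equivalence_hits_loop[OF f]; simp add: chain_len_def)+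
  then obtain x y where xy: "x \<in> points (theta n) (theta_len n)" "f x = Interior 0 (1 / 2)"
     "y \<in> points (theta n) (theta_len n)" "f y = Interior ?e (1 / 2)"
    by (metis (no_types, lifting) G.M.topspace_mtopology imageE)
  have "real n / 2 = \<bar>\<phi> (f x) - \<phi> (f y)\<bar>"
    using n unfolding xy(2,4) by (auto simp: \<phi>_def pos_def field_simps)
  also have "\<dots> \<le> path_dist (chain n) (chain_len n) (f x) (f y)"
    using lip xy(1,3) unfolding lipschitz_map_def by (intro \<phi>_lip) blast+
  also have "\<dots> \<le> L * path_dist (theta n) (theta_len n) x y"
    using lip xy(1,3) unfolding lipschitz_map_def by blast
  also have "\<dots> \<le> L * (real n / (real n + 1))"
    using theta_diameter[OF _ xy(1,3)] n L by (intro mult_left_mono) auto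
  finally have "real n * ((real n + 1) / 2) \<le> real n * L" using n by (simp add: field_simps)
  then show "(real n + 1) / 2 \<le> L" using n by (subst (asm) mult_le_cancel_left_pos) auto
qed (use n in simp)

theorem theorem7:
  shows "\<exists>K>0. \<forall>n\<ge>2. \<forall>\<epsilon>::real. 0 < \<epsilon> \<and> \<epsilon> \<le> 1 \<longrightarrow>
           ereal (1 / K * ln (real n / \<epsilon>)) \<le> lipschitz_diam (thick_part n \<epsilon>) \<and>
           lipschitz_diam (thick_part n \<epsilon>) \<le> ereal (K * ln (real n / \<epsilon>))"
proof (intro exI[of _ 7] conjI allI impI)
  fix n :: nat and \<epsilon> :: real
  assume n: "2 \<le> n" and "0 < \<epsilon> \<and> \<epsilon> \<le> 1"
  then have \<epsilon>: "0 < \<epsilon>" "\<epsilon> \<le> 1" by auto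
  have diam: "lipschitz_dist x y \<le> lipschitz_diam (thick_part n \<epsilon>)"
    if "x \<in> thick_part n \<epsilon>" "y \<in> thick_part n \<epsilon>" for x y
    unfolding lipschitz_diam_def using that by (intro SUP_upper2[of "(x, y)"]) auto
  define A where "A = ln ((real n + 1) / 2)"
  define B where "B = ln (1 / (4 * \<epsilon>))"
  have A: "ereal A \<le> lipschitz_diam (thick_part n \<epsilon>)"
    using theta_chain_dist[OF n] diam[OF theta_thick[OF n \<epsilon>] chain_thick[OF n \<epsilon>]]
    unfolding A_def by (rule order_trans)
  have B: "ereal B \<le> lipschitz_diam (thick_part n \<epsilon>)"
    using pinched_rose_dist[OF n \<epsilon>] diam[OF pinched_rose_thick[OF n \<epsilon>] rose_thick[OF n \<epsilon>(2)]]
    unfolding B_def by (rule order_trans)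
  \<comment> \<open>The mean of \<open>n\<close> and 1 is at least the square root of
    \<open>n\<close>.\<close>
  have "real n \<le> ((real n + 1) / 2) ^ 2"
    using zero_le_power2[of "real n - 1"] by (simp add: power2_eq_square field_simps)
  then have "ln (real n) \<le> ln (((real n + 1) / 2) ^ 2)" using n by (subst ln_le_cancel_iff) auto
  then have 1: "ln (real n) \<le> 2 * A" using n by (simp add: A_def ln_realpow)
  \<comment> \<open>The base is at least \<open>3 / 2\<close> because \<open>n \<ge> 2\<close>; this
    pays for the \<open>ln 4\<close> lost in \<open>B\<close>.\<close>
  have "(4::real) \<le> (3 / 2) ^ 4" by (simp add: power4_eq_xxxx)
  also have "\<dots> \<le> ((real n + 1) / 2) ^ 4" using n by (intro power_mono) auto
  finally have "ln 4 \<le> ln (((real n + 1) / 2) ^ 4)" using n by (subst ln_le_cancel_iff) auto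
  then have 2: "ln 4 \<le> 4 * A" using n by (simp add: A_def ln_realpow)
  have "ln (real n / \<epsilon>) = ln (real n) + (ln 4 + B)"
    using n \<epsilon> by (simp add: B_def ln_div ln_mult)
  \<comment> \<open>\<open>2 * A\<close> bounds \<open>ln n\<close> and \<open>4 * A\<close> bounds
    \<open>ln 4\<close>; with \<open>B\<close> this makes seven terms, each at most
    \<open>max A B\<close>, even where \<open>B\<close> is negative.\<close>
  then have "ln (real n / \<epsilon>) \<le> 7 * max A B" using 1 2 by (simp add: max_def)
  then have "1 / 7 * ln (real n / \<epsilon>) \<le> max A B" by simp
  then have "ereal (1 / 7 * ln (real n / \<epsilon>)) \<le> ereal (max A B)" by (simp only: ereal_less_eq)
  also have "\<dots> \<le> lipschitz_diam (thick_part n \<epsilon>)" using A B by (simp add: max_def)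
  finally show "ereal (1 / 7 * ln (real n / \<epsilon>)) \<le> lipschitz_diam (thick_part n \<epsilon>)" .
  define x where "x = real n / \<epsilon>"
  \<comment> \<open>With \<open>x \<ge> 2\<close> a power of \<open>x\<close> absorbs the factor 6:
    \<open>6 * x ^ 2 \<le> 2 ^ 5 * x ^ 2 \<le> x ^ 7\<close>, so the same 7 serves both
    bounds.\<close>
  have x: "2 \<le> x" using n \<epsilon> mult_mono[of 2 "real n" \<epsilon> 1] by (simp add: x_def field_simps)
  have "\<epsilon> ^ 2 \<le> \<epsilon> * 1" using \<epsilon> unfolding power2_eq_square by (intro mult_left_mono) auto
  then have "6 * real n ^ 2 / \<epsilon> \<le> 6 * real n ^ 2 / \<epsilon> ^ 2" using \<epsilon> by (intro divide_left_mono) auto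
  also have "\<dots> = 6 * x ^ 2" by (simp add: x_def power_divide)
  also have "\<dots> \<le> 2 ^ 5 * x ^ 2" by simp
  also have "\<dots> \<le> x ^ 5 * x ^ 2" using x by (intro mult_right_mono power_mono) auto
  also have "\<dots> = x ^ 7" by (simp flip: power_add)
  finally have "ln (6 * real n ^ 2 / \<epsilon>) \<le> ln (x ^ 7)" using n \<epsilon> x by (subst ln_le_cancel_iff) auto
  also have "\<dots> = 7 * ln (real n / \<epsilon>)" using x by (simp add: x_def ln_realpow)
  finally have le: "ereal (ln (6 * real n ^ 2 / \<epsilon>)) \<le> ereal (7 * ln (real n / \<epsilon>))" by simp
  show "lipschitz_diam (thick_part n \<epsilon>) \<le> ereal (7 * ln (real n / \<epsilon>))"
    unfolding lipschitz_diam_def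
  proof (rule SUP_least)
    fix z assume "z \<in> thick_part n \<epsilon> \<times> thick_part n \<epsilon>"
    then obtain G l H m where z: "z = ((G, l), (H, m))"
      "(G, l) \<in> thick_part n \<epsilon>" "(H, m) \<in> thick_part n \<epsilon>" by auto
    show "(case z of (x, y) \<Rightarrow> lipschitz_dist x y) \<le> ereal (7 * ln (real n / \<epsilon>))"
      using order_trans[OF lipschitz_dist_le[OF z(2,3) \<epsilon>(1)] le] n z(1) by simp
  qed
qed simp

end
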